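(* Let $\ast$ be the translation from $\mathcal{L}$ to $\mathcal{L}^{\mathrm{BM}}$ defined in the context. (a) The translation $\ast$ is a faithful embedding of I-FOL in BM-FOL; that is, for all formulas $\varphi_1,\dots,\varphi_n,\psi$ of $\mathcal{L}$, $$\varphi_1,\dots,\varphi_n\vdash_{\text{I-FOL}}\psi\quad\text{iff}\quad \varphi_1^\ast,\dots,\varphi_n^\ast\vdash_{\text{BM-FOL}}\psi^\ast .$$ (b) If the schema of Reverse Subsumption, $\Box_G\varphi\to\Box_D\varphi$, is added to BM-FOL, then $\ast$ is a faithful embedding of classical first-order logic FOL (in the language $\mathcal{L}$) in the resulting system; that is, for all formulas $\varphi_1,\dots,\varphi_n,\psi$ of $\mathcal{L}$, $$\varphi_1,\dots,\varphi_n\vdash_{\text{FOL}}\psi\quad\text{iff}\quad \varphi_1^\ast,\dots,\varphi_n^\ast\vdash_{\text{BM-FOL + Reverse Subsumption}}\psi^\ast .$$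
   Context: **Languages.** $\mathcal{L}$ is a first-order language with a relational signature and logical operators $\neg,\wedge,\vee,\to,\forall,\exists$; identity, if present, counts as an atomic predicate and is governed by its usual axioms. $\mathcal{L}^{\mathrm{BM}}$ adds to $\mathcal{L}$ two modal operators $\Box_D$, $\Box_G$, with $\Diamond_D=\neg\Box_D\neg$ and $\Diamond_G=\neg\Box_G\neg$. **Systems.** I-FOL is intuitionistic first-order logic in $\mathcal{L}$. BM-FOL is classical first-order logic in $\mathcal{L}^{\mathrm{BM}}$ (ordinary quantifier axioms and rules, so that the Converse Barcan Formula $\exists x\Diamond\varphi\to\Diamond\exists x\varphi$ is provable for each modality; the Barcan Formula is not assumed), together with: - S4 for $\Box_D$: the axioms K, T, 4 and the rule of necessitation; - S4.2 for $\Box_G$: the axioms K, T, 4, the rule of necessitation, and $\Diamond_G\Box_G\varphi\to\Box_G\Diamond_G\varphi$; - G-stability of every atomic formula $\varphi$: $\Diamond_G\varphi\to\Box_G\varphi$; - Subsumption: $\Box_D\varphi\to\Box_G\varphi$; - Mixed.2: $\Diamond_G\Box_D\varphi\to\Box_D\Diamond_G\varphi$. In a modal system, $\varphi_1,\dots,\varphi_n\vdash\psi$ means that $(\varphi_1\wedge\dots\wedge\varphi_n)\to\psi$ is a theorem; necessitation applies to theorems only. **Translation $\ast$.** $\varphi\mapsto\Box_D\varphi$ for $\varphi$ atomic; $(\varphi\vee\psi)^\ast=\varphi^\ast\vee\psi^\ast$; $(\varphi\wedge\psi)^\ast=\varphi^\ast\wedge\psi^\ast$; $(\varphi\to\psi)^\ast=\Box_D(\varphi^\ast\to\psi^\ast)$;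 $(\neg\varphi)^\ast=\Box_D\neg\varphi^\ast$; $(\exists x\,\varphi)^\ast=\Diamond_G\exists x\,\varphi^\ast$; $(\forall x\,\varphi)^\ast=\Box_D\forall x\,\varphi^\ast$. *)

theory Defs
  imports Main
begin

text \<open>
  A relational language: a pair \<open>(p, n)\<close> in \<open>rels\<close> is an \<open>n\<close>-place predicate symbol; \<open>ident\<close> says
  whether identity is present. As there are no function symbols, the only terms are variables.
  Variables are de Bruijn indices, so formulas are taken up to renaming of bound variables.
\<close>

record 'p lang =
  rels :: "('p \<times> nat) set"
  ident :: bool

datatype 'p fm =
    Rel 'p "nat list"
  | Eq nat nat
  | Neg "'p fm"
  | And "'p fm" "'p fm"
  | Or "'p fm" "'p fm"
  | Imp "'p fm" "'p fm"
  | Forall "'p fm"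
  | Exists "'p fm"

datatype modality = D | G

datatype 'p mfm =
    MRel 'p "nat list"
  | MEq nat nat
  | MNeg "'p mfm"  ("\<^bold>\<not> _" [70] 70)
  | MAnd "'p mfm" "'p mfm"  (infixr "\<^bold>\<and>" 65)
  | MOr "'p mfm" "'p mfm"  (infixr "\<^bold>\<or>" 60)
  | MImp "'p mfm" "'p mfm"  (infixr "\<^bold>\<rightarrow>" 55)
  | MForall "'p mfm"
  | MExists "'p mfm"
  | Box modality "'p mfm"

abbreviation Dia :: "modality \<Rightarrow> 'p mfm \<Rightarrow> 'p mfm" where
  "Dia m \<phi> \<equiv> \<^bold>\<not> Box m (\<^bold>\<not> \<phi>)"

primrec in_lang :: "'p lang \<Rightarrow> 'p fm \<Rightarrow> bool" where
  "in_lang L (Rel p xs) = ((p, length xs) \<in> rels L)"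
| "in_lang L (Eq x y) = ident L"
| "in_lang L (Neg \<phi>) = in_lang L \<phi>"
| "in_lang L (And \<phi> \<psi>) = (in_lang L \<phi> \<and> in_lang L \<psi>)"
| "in_lang L (Or \<phi> \<psi>) = (in_lang L \<phi> \<and> in_lang L \<psi>)"
| "in_lang L (Imp \<phi> \<psi>) = (in_lang L \<phi> \<and> in_lang L \<psi>)"
| "in_lang L (Forall \<phi>) = in_lang L \<phi>"
| "in_lang L (Exists \<phi>) = in_lang L \<phi>"

primrec in_mlang :: "'p lang \<Rightarrow> 'p mfm \<Rightarrow> bool" where
  "in_mlang L (MRel p xs) = ((p, length xs) \<in> rels L)"
| "in_mlang L (MEq x y) = ident L"
| "in_mlang L (\<^bold>\<not> \<phi>) = in_mlang L \<phi>"
| "in_mlang L (\<phi> \<^bold>\<and> \<psi>) = (in_mlang L \<phi> \<and> in_mlang L \<psi>)"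
| "in_mlang L (\<phi> \<^bold>\<or> \<psi>) = (in_mlang L \<phi> \<and> in_mlang L \<psi>)"
| "in_mlang L (\<phi> \<^bold>\<rightarrow> \<psi>) = (in_mlang L \<phi> \<and> in_mlang L \<psi>)"
| "in_mlang L (MForall \<phi>) = in_mlang L \<phi>"
| "in_mlang L (MExists \<phi>) = in_mlang L \<phi>"
| "in_mlang L (Box m \<phi>) = in_mlang L \<phi>"

text \<open>
  Substitution of variables for variables. \<open>lift\<close> makes room for a new variable \<open>0\<close>, so
  \<open>lift \<phi>\<close> does not contain \<open>0\<close> free; \<open>inst x \<phi>\<close> replaces the variable \<open>0\<close> by \<open>x\<close> and removes it
  from the context, as required when a quantifier in front of \<open>\<phi>\<close> is dropped.
\<close>

definition under_binder :: "(nat \<Rightarrow> nat) \<Rightarrow> nat \<Rightarrow> nat" where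
  "under_binder r = case_nat 0 (\<lambda>n. Suc (r n))"

primrec rename :: "(nat \<Rightarrow> nat) \<Rightarrow> 'p fm \<Rightarrow> 'p fm" where
  "rename r (Rel p xs) = Rel p (map r xs)"
| "rename r (Eq x y) = Eq (r x) (r y)"
| "rename r (Neg \<phi>) = Neg (rename r \<phi>)"
| "rename r (And \<phi> \<psi>) = And (rename r \<phi>) (rename r \<psi>)"
| "rename r (Or \<phi> \<psi>) = Or (rename r \<phi>) (rename r \<psi>)"
| "rename r (Imp \<phi> \<psi>) = Imp (rename r \<phi>) (rename r \<psi>)"
| "rename r (Forall \<phi>) = Forall (rename (under_binder r) \<phi>)"
| "rename r (Exists \<phi>) = Exists (rename (under_binder r) \<phi>)"

primrec mrename :: "(nat \<Rightarrow> nat) \<Rightarrow> 'p mfm \<Rightarrow> 'p mfm" where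
  "mrename r (MRel p xs) = MRel p (map r xs)"
| "mrename r (MEq x y) = MEq (r x) (r y)"
| "mrename r (\<^bold>\<not> \<phi>) = \<^bold>\<not> mrename r \<phi>"
| "mrename r (\<phi> \<^bold>\<and> \<psi>) = mrename r \<phi> \<^bold>\<and> mrename r \<psi>"
| "mrename r (\<phi> \<^bold>\<or> \<psi>) = mrename r \<phi> \<^bold>\<or> mrename r \<psi>"
| "mrename r (\<phi> \<^bold>\<rightarrow> \<psi>) = mrename r \<phi> \<^bold>\<rightarrow> mrename r \<psi>"
| "mrename r (MForall \<phi>) = MForall (mrename (under_binder r) \<phi>)"
| "mrename r (MExists \<phi>) = MExists (mrename (under_binder r) \<phi>)"
| "mrename r (Box m \<phi>) = Box m (mrename r \<phi>)"

abbreviation lift :: "'p fm \<Rightarrow> 'p fm" where "lift \<equiv> rename Suc"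
abbreviation mlift :: "'p mfm \<Rightarrow> 'p mfm" where "mlift \<equiv> mrename Suc"
abbreviation inst :: "nat \<Rightarrow> 'p fm \<Rightarrow> 'p fm" where "inst x \<equiv> rename (case_nat x id)"
abbreviation minst :: "nat \<Rightarrow> 'p mfm \<Rightarrow> 'p mfm" where "minst x \<equiv> mrename (case_nat x id)"

text \<open>
  Natural deduction in the language \<open>L\<close>. The rules are those of intuitionistic first-order logic
  (with identity if \<open>ident L\<close>); \<open>X\<close> is a set of additional axioms. The explicit \<open>in_lang\<close> premises
  ensure that every formula in a derivation belongs to \<open>L\<close>. The free variables of the assumptions
  are parameters: the eigenvariable conditions are expressed by \<open>lift\<close>.
\<close>

inductive natded :: "'p lang \<Rightarrow> 'p fm set \<Rightarrow> 'p fm list \<Rightarrow> 'p fm \<Rightarrow> bool" for L X where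
  Assm: "\<forall>\<chi> \<in> set \<Gamma>. in_lang L \<chi> \<Longrightarrow> \<phi> \<in> set \<Gamma> \<Longrightarrow> natded L X \<Gamma> \<phi>"
| Extra: "\<forall>\<chi> \<in> set \<Gamma>. in_lang L \<chi> \<Longrightarrow> in_lang L \<phi> \<Longrightarrow> \<phi> \<in> X \<Longrightarrow> natded L X \<Gamma> \<phi>"
| AndI: "natded L X \<Gamma> \<phi> \<Longrightarrow> natded L X \<Gamma> \<psi> \<Longrightarrow> natded L X \<Gamma> (And \<phi> \<psi>)"
| AndE1: "natded L X \<Gamma> (And \<phi> \<psi>) \<Longrightarrow> natded L X \<Gamma> \<phi>"
| AndE2: "natded L X \<Gamma> (And \<phi> \<psi>) \<Longrightarrow> natded L X \<Gamma> \<psi>"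
| OrI1: "natded L X \<Gamma> \<phi> \<Longrightarrow> in_lang L \<psi> \<Longrightarrow> natded L X \<Gamma> (Or \<phi> \<psi>)"
| OrI2: "natded L X \<Gamma> \<psi> \<Longrightarrow> in_lang L \<phi> \<Longrightarrow> natded L X \<Gamma> (Or \<phi> \<psi>)"
| OrE: "natded L X \<Gamma> (Or \<phi> \<psi>) \<Longrightarrow> natded L X (\<phi> # \<Gamma>) \<chi> \<Longrightarrow> natded L X (\<psi> # \<Gamma>) \<chi> \<Longrightarrow>
    natded L X \<Gamma> \<chi>"
| ImpI: "natded L X (\<phi> # \<Gamma>) \<psi> \<Longrightarrow> natded L X \<Gamma> (Imp \<phi> \<psi>)"
| ImpE: "natded L X \<Gamma> (Imp \<phi> \<psi>) \<Longrightarrow> natded L X \<Gamma> \<phi> \<Longrightarrow> natded L X \<Gamma> \<psi>"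
| NegI: "natded L X (\<phi> # \<Gamma>) \<psi> \<Longrightarrow> natded L X (\<phi> # \<Gamma>) (Neg \<psi>) \<Longrightarrow> natded L X \<Gamma> (Neg \<phi>)"
| NegE: "natded L X \<Gamma> (Neg \<phi>) \<Longrightarrow> natded L X \<Gamma> \<phi> \<Longrightarrow> in_lang L \<psi> \<Longrightarrow> natded L X \<Gamma> \<psi>"
| ForallI: "natded L X (map lift \<Gamma>) \<phi> \<Longrightarrow> natded L X \<Gamma> (Forall \<phi>)"
| ForallE: "natded L X \<Gamma> (Forall \<phi>) \<Longrightarrow> natded L X \<Gamma> (inst x \<phi>)"
| ExistsI: "natded L X \<Gamma> (inst x \<phi>) \<Longrightarrow> natded L X \<Gamma> (Exists \<phi>)"
| ExistsE: "natded L X \<Gamma> (Exists \<phi>) \<Longrightarrow> natded L X (\<phi> # map lift \<Gamma>) (lift \<psi>) \<Longrightarrow>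
    natded L X \<Gamma> \<psi>"
| EqI: "\<forall>\<chi> \<in> set \<Gamma>. in_lang L \<chi> \<Longrightarrow> ident L \<Longrightarrow> natded L X \<Gamma> (Eq x x)"
| EqE: "natded L X \<Gamma> (Eq x y) \<Longrightarrow> natded L X \<Gamma> (inst x \<phi>) \<Longrightarrow> natded L X \<Gamma> (inst y \<phi>)"

definition IFOL :: "'p lang \<Rightarrow> 'p fm list \<Rightarrow> 'p fm \<Rightarrow> bool" where
  "IFOL L \<Gamma> \<psi> \<longleftrightarrow> natded L {} \<Gamma> \<psi>"

definition FOL :: "'p lang \<Rightarrow> 'p fm list \<Rightarrow> 'p fm \<Rightarrow> bool" where
  "FOL L \<Gamma> \<psi> \<longleftrightarrow> natded L {Or \<phi> (Neg \<phi>) | \<phi>. True} \<Gamma> \<psi>"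

text \<open>
  A Hilbert system for bimodal first-order logic. The identity axioms are reflexivity and
  indiscernibility for all formulas of the language, including modal ones.
\<close>

inductive bm_axiom :: "'p mfm \<Rightarrow> bool" where
  P1: "bm_axiom (\<phi> \<^bold>\<rightarrow> \<psi> \<^bold>\<rightarrow> \<phi>)"
| P2: "bm_axiom ((\<phi> \<^bold>\<rightarrow> \<psi> \<^bold>\<rightarrow> \<chi>) \<^bold>\<rightarrow> (\<phi> \<^bold>\<rightarrow> \<psi>) \<^bold>\<rightarrow> \<phi> \<^bold>\<rightarrow> \<chi>)"
| P3: "bm_axiom (\<phi> \<^bold>\<rightarrow> \<psi> \<^bold>\<rightarrow> \<phi> \<^bold>\<and> \<psi>)"
| P4: "bm_axiom (\<phi> \<^bold>\<and> \<psi> \<^bold>\<rightarrow> \<phi>)"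
| P5: "bm_axiom (\<phi> \<^bold>\<and> \<psi> \<^bold>\<rightarrow> \<psi>)"
| P6: "bm_axiom (\<phi> \<^bold>\<rightarrow> \<phi> \<^bold>\<or> \<psi>)"
| P7: "bm_axiom (\<psi> \<^bold>\<rightarrow> \<phi> \<^bold>\<or> \<psi>)"
| P8: "bm_axiom ((\<phi> \<^bold>\<rightarrow> \<chi>) \<^bold>\<rightarrow> (\<psi> \<^bold>\<rightarrow> \<chi>) \<^bold>\<rightarrow> \<phi> \<^bold>\<or> \<psi> \<^bold>\<rightarrow> \<chi>)"
| P9: "bm_axiom ((\<phi> \<^bold>\<rightarrow> \<psi>) \<^bold>\<rightarrow> (\<phi> \<^bold>\<rightarrow> \<^bold>\<not> \<psi>) \<^bold>\<rightarrow> \<^bold>\<not> \<phi>)"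
| P10: "bm_axiom (\<^bold>\<not> \<^bold>\<not> \<phi> \<^bold>\<rightarrow> \<phi>)"
| Q1: "bm_axiom (MForall \<phi> \<^bold>\<rightarrow> minst x \<phi>)"
| Q2: "bm_axiom (minst x \<phi> \<^bold>\<rightarrow> MExists \<phi>)"
| I1: "bm_axiom (MEq x x)"
| I2: "bm_axiom (MEq x y \<^bold>\<rightarrow> minst x \<phi> \<^bold>\<rightarrow> minst y \<phi>)"
| K: "bm_axiom (Box m (\<phi> \<^bold>\<rightarrow> \<psi>) \<^bold>\<rightarrow> Box m \<phi> \<^bold>\<rightarrow> Box m \<psi>)"
| T: "bm_axiom (Box m \<phi> \<^bold>\<rightarrow> \<phi>)"
| Four: "bm_axiom (Box m \<phi> \<^bold>\<rightarrow> Box m (Box m \<phi>))"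
| G2: "bm_axiom (Dia G (Box G \<phi>) \<^bold>\<rightarrow> Box G (Dia G \<phi>))"
| Stab_Rel: "bm_axiom (Dia G (MRel p xs) \<^bold>\<rightarrow> Box G (MRel p xs))"
| Stab_Eq: "bm_axiom (Dia G (MEq x y) \<^bold>\<rightarrow> Box G (MEq x y))"
| Subsumption: "bm_axiom (Box D \<phi> \<^bold>\<rightarrow> Box G \<phi>)"
| Mixed2: "bm_axiom (Dia G (Box D \<phi>) \<^bold>\<rightarrow> Box D (Dia G \<phi>))"

text \<open>
  Theorems of the system with additional axioms \<open>X\<close>. In the rules for the quantifiers, \<open>mlift\<close>
  expresses that the quantified variable is not free in the other formula.
\<close>

inductive bm_thm :: "'p lang \<Rightarrow> 'p mfm set \<Rightarrow> 'p mfm \<Rightarrow> bool" for L X where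
  Ax: "bm_axiom \<phi> \<Longrightarrow> in_mlang L \<phi> \<Longrightarrow> bm_thm L X \<phi>"
| Extra: "\<phi> \<in> X \<Longrightarrow> in_mlang L \<phi> \<Longrightarrow> bm_thm L X \<phi>"
| MP: "bm_thm L X (\<phi> \<^bold>\<rightarrow> \<psi>) \<Longrightarrow> bm_thm L X \<phi> \<Longrightarrow> bm_thm L X \<psi>"
| Gen_Forall: "bm_thm L X (mlift \<phi> \<^bold>\<rightarrow> \<psi>) \<Longrightarrow> bm_thm L X (\<phi> \<^bold>\<rightarrow> MForall \<psi>)"
| Gen_Exists: "bm_thm L X (\<phi> \<^bold>\<rightarrow> mlift \<psi>) \<Longrightarrow> bm_thm L X (MExists \<phi> \<^bold>\<rightarrow> \<psi>)"
| Nec: "bm_thm L X \<phi> \<Longrightarrow> bm_thm L X (Box m \<phi>)"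

fun conj_imp :: "'p mfm list \<Rightarrow> 'p mfm \<Rightarrow> 'p mfm" where
  "conj_imp [] \<psi> = \<psi>"
| "conj_imp (\<phi> # \<Gamma>) \<psi> = (foldl MAnd \<phi> \<Gamma> \<^bold>\<rightarrow> \<psi>)"

definition BMFOL :: "'p lang \<Rightarrow> 'p mfm list \<Rightarrow> 'p mfm \<Rightarrow> bool" where
  "BMFOL L \<Gamma> \<psi> \<longleftrightarrow> bm_thm L {} (conj_imp \<Gamma> \<psi>)"

definition BMFOL_RS :: "'p lang \<Rightarrow> 'p mfm list \<Rightarrow> 'p mfm \<Rightarrow> bool" where
  "BMFOL_RS L \<Gamma> \<psi> \<longleftrightarrow> bm_thm L {Box G \<phi> \<^bold>\<rightarrow> Box D \<phi> | \<phi>. True} (conj_imp \<Gamma> \<psi>)"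

primrec star :: "'p fm \<Rightarrow> 'p mfm" where
  "star (Rel p xs) = Box D (MRel p xs)"
| "star (Eq x y) = Box D (MEq x y)"
| "star (Or \<phi> \<psi>) = star \<phi> \<^bold>\<or> star \<psi>"
| "star (And \<phi> \<psi>) = star \<phi> \<^bold>\<and> star \<psi>"
| "star (Imp \<phi> \<psi>) = Box D (star \<phi> \<^bold>\<rightarrow> star \<psi>)"
| "star (Neg \<phi>) = Box D (\<^bold>\<not> star \<phi>)"
| "star (Exists \<phi>) = Dia G (MExists (star \<phi>))"
| "star (Forall \<phi>) = Box D (MForall (star \<phi>))"

end

theory Submission
  imports Defs "HOL-Library.Countable_Set"
begin

text \<open>
  Preservation of derivability rests on two properties of every translated formula
  \<open>star \<phi>\<close>. It is stable: \<open>star \<phi> \<^bold>\<rightarrow> Box D (star \<phi>)\<close> is a theorem, so a box may be put in front of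
  whatever follows from translated hypotheses; this gives the introduction rules for implication,
  negation and \<open>Forall\<close> (\<open>ent_boxI_star\<close>). And it is dense: \<open>Dia G (star \<phi>) \<^bold>\<rightarrow> star \<phi>\<close> is a theorem,
  so when a translated formula is to be derived, \<open>Dia G (MExists (star \<phi>))\<close> is as good a hypothesis
  as \<open>MExists (star \<phi>)\<close>; this gives the elimination rule for \<open>Exists\<close> (\<open>ent_diaE_star\<close>). The axiom
  \<open>Mixed2\<close> makes stability pass through \<open>Dia G\<close> and density through \<open>Box D\<close>. Reverse Subsumption
  turns density in the form \<open>\<^bold>\<not> star \<phi> \<^bold>\<rightarrow> Box G (\<^bold>\<not> star \<phi>)\<close> into the translation of excluded
  middle.

  For faithfulness, read \<open>Box G\<close> as the identity. All axioms for \<open>Box G\<close>, stability of atoms and the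
  interaction axioms then hold for trivial reasons, and \<open>star\<close> becomes Goedel's translation into S4.
  It remains to refute the translations of underivable sequents in a model of quantified S4. A
  topological model in the style of Rasiowa and Sikorski serves: its points are the saturated
  theories (deductively closed, prime, with witnesses for existential formulas), \<open>Box D\<close> is the
  interior operator of the topology with basic open sets \<open>{T. set \<Gamma> \<subseteq> T}\<close>, and the individuals at
  every point are the variables. That all points share one countable domain makes the argument
  shorter than one with Kripke models, where the domains must grow: here a theory need not be
  extended by new parameters when passing to another point. In this model \<open>star \<phi>\<close> holds exactly at
  the theories containing \<open>\<phi>\<close> (\<open>holds_star_iff\<close>), because sequents that are not derivable are
  separated by saturated theories (\<open>saturated_extension\<close>). Under Reverse Subsumption the same
  semantics is used with the space consisting of a single saturated classical theory: on a one-point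
  space the interior operator is the identity too.

  Saturated theories are built by enumerating formulas, which requires a countable language. In
  general, the theories are formed in the sublanguage of the predicate symbols that occur in
  the sequent; theorems of the full bimodal language are still valid in the resulting model, where
  the remaining predicates are empty.
\<close>

section \<open>Renaming of variables\<close>

lemma under_binder_simps [simp]: "under_binder r 0 = 0" "under_binder r (Suc n) = Suc (r n)"
  by (simp_all add: under_binder_def)

lemma under_binder_id [simp]: "under_binder id = id"
  by (auto simp: fun_eq_iff under_binder_def split: nat.split)

lemma under_binder_comp: "under_binder r \<circ> under_binder s = under_binder (r \<circ> s)"
  by (auto simp: fun_eq_iff under_binder_def split: nat.split)

lemma inst_comp_under_binder: "case_nat a s \<circ> under_binder r = case_nat a (s \<circ> r)"
  by (auto simp: fun_eq_iff under_binder_def split: nat.split)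

lemma comp_case_nat: "r \<circ> case_nat x s = case_nat (r x) (r \<circ> s)"
  by (auto simp: fun_eq_iff split: nat.split)

lemma case_nat_comp_Suc [simp]: "case_nat x s \<circ> Suc = s"
  by (auto simp: fun_eq_iff)

lemma under_binder_comp_Suc: "under_binder r \<circ> Suc = Suc \<circ> r"
  by (auto simp: fun_eq_iff)

lemma case_nat_0_Suc: "case_nat 0 Suc = id"
  by (auto simp: fun_eq_iff split: nat.split)

lemma rename_id [simp]: "rename id \<phi> = \<phi>"
  by (induction \<phi>) (simp_all flip: id_def)

lemma mrename_id [simp]: "mrename id \<phi> = \<phi>"
  by (induction \<phi>) (simp_all flip: id_def)

lemma rename_rename: "rename r (rename s \<phi>) = rename (r \<circ> s) \<phi>"
  by (induction \<phi> arbitrary: r s) (simp_all add: under_binder_comp)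

lemma mrename_mrename: "mrename r (mrename s \<phi>) = mrename (r \<circ> s) \<phi>"
  by (induction \<phi> arbitrary: r s) (simp_all add: under_binder_comp)

lemma rename_inst: "rename r (inst x \<phi>) = inst (r x) (rename (under_binder r) \<phi>)"
  by (simp add: rename_rename comp_case_nat inst_comp_under_binder)

lemma inst_rename_under_binder: "inst x (rename (under_binder r) \<phi>) = rename (case_nat x r) \<phi>"
  by (simp add: rename_rename inst_comp_under_binder)

lemma rename_under_binder_lift: "rename (under_binder r) (lift \<phi>) = lift (rename r \<phi>)"
  by (simp add: rename_rename under_binder_comp_Suc)

lemma inst_0_lift_under_binder [simp]: "inst 0 (rename (under_binder Suc) \<phi>) = \<phi>"
  by (simp add: inst_rename_under_binder case_nat_0_Suc)

lemma minst_0_lift_under_binder [simp]: "minst 0 (mrename (under_binder Suc) \<phi>) = \<phi>"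
  by (simp add: mrename_mrename inst_comp_under_binder case_nat_0_Suc)

lemma in_lang_rename [simp]: "in_lang L (rename r \<phi>) = in_lang L \<phi>"
  by (induction \<phi> arbitrary: r) simp_all

lemma in_mlang_mrename [simp]: "in_mlang L (mrename r \<phi>) = in_mlang L \<phi>"
  by (induction \<phi> arbitrary: r) simp_all

lemma star_rename: "star (rename r \<phi>) = mrename r (star \<phi>)"
  by (induction \<phi> arbitrary: r) simp_all

lemma in_mlang_star [simp]: "in_mlang L (star \<phi>) = in_lang L \<phi>"
  by (induction \<phi>) simp_all

text \<open>
  Finiteness of the set of free variables of a formula, expressed through the action of renamings.
\<close>

lemma rename_bound: "\<exists>n. \<forall>r s. (\<forall>x<n. r x = s x) \<longrightarrow> rename r \<phi> = rename s \<phi>"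
proof (induction \<phi>)
  case (Rel p xs)
  obtain n where "\<forall>x\<in>set xs. x < n"
    using finite_nat_set_iff_bounded by blast
  then show ?case
    by (intro exI[of _ n]) simp
next
  case (Eq x y)
  show ?case
    by (intro exI[of _ "Suc (max x y)"]) (simp add: less_Suc_eq_le)
next
  case (And \<phi> \<psi>)
  then obtain n k
    where "\<forall>r s. (\<forall>x<n. r x = s x) \<longrightarrow> rename r \<phi> = rename s \<phi>"
      and "\<forall>r s. (\<forall>x<k. r x = s x) \<longrightarrow> rename r \<psi> = rename s \<psi>"
    by blast
  then show ?case
    by (intro exI[of _ "max n k"]) (simp add: less_max_iff_disj)
next
  case (Or \<phi> \<psi>)
  then obtain n k
    where "\<forall>r s. (\<forall>x<n. r x = s x) \<longrightarrow> rename r \<phi> = rename s \<phi>"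
      and "\<forall>r s. (\<forall>x<k. r x = s x) \<longrightarrow> rename r \<psi> = rename s \<psi>"
    by blast
  then show ?case
    by (intro exI[of _ "max n k"]) (simp add: less_max_iff_disj)
next
  case (Imp \<phi> \<psi>)
  then obtain n k
    where "\<forall>r s. (\<forall>x<n. r x = s x) \<longrightarrow> rename r \<phi> = rename s \<phi>"
      and "\<forall>r s. (\<forall>x<k. r x = s x) \<longrightarrow> rename r \<psi> = rename s \<psi>"
    by blast
  then show ?case
    by (intro exI[of _ "max n k"]) (simp add: less_max_iff_disj)
next
  case (Forall \<phi>)
  then obtain n where n: "\<And>r s. (\<forall>x<n. r x = s x) \<Longrightarrow> rename r \<phi> = rename s \<phi>"
    by blast
  have "rename (under_binder r) \<phi> = rename (under_binder s) \<phi>" if "\<forall>x<n. r x = s x" for r s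
    using that by (intro n) (simp add: under_binder_def split: nat.split)
  then show ?case
    by (intro exI[of _ n]) simp
next
  case (Exists \<phi>)
  then obtain n where n: "\<And>r s. (\<forall>x<n. r x = s x) \<Longrightarrow> rename r \<phi> = rename s \<phi>"
    by blast
  have "rename (under_binder r) \<phi> = rename (under_binder s) \<phi>" if "\<forall>x<n. r x = s x" for r s
    using that by (intro n) (simp add: under_binder_def split: nat.split)
  then show ?case
    by (intro exI[of _ n]) simp
qed simp_all

text \<open>
  A fresh variable \<open>a\<close> can be exchanged for the variable \<open>0\<close> of a lifted context. This turns
  derivations about a fresh free variable into the premises of the quantifier rules, where
  freshness is expressed by \<open>lift\<close>.
\<close>

lemma fresh_variable:
  "\<exists>a. \<forall>\<chi>\<in>set \<Gamma>. rename (Suc(a := 0)) \<chi> = lift \<chi> \<and> rename (Suc(a := 0)) (inst a \<chi>) = \<chi>"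
proof -
  have "\<exists>n. \<forall>\<chi>\<in>set \<Gamma>. \<forall>r s. (\<forall>x<n. r x = s x) \<longrightarrow> rename r \<chi> = rename s \<chi>"
  proof (induction \<Gamma>)
    case (Cons \<phi> \<Gamma>)
    obtain n where n: "\<And>r s. (\<forall>x<n. r x = s x) \<Longrightarrow> rename r \<phi> = rename s \<phi>"
      using rename_bound by blast
    obtain k where k: "\<And>\<chi> r s. \<chi> \<in> set \<Gamma> \<Longrightarrow> (\<forall>x<k. r x = s x) \<Longrightarrow> rename r \<chi> = rename s \<chi>"
      using Cons.IH by blast
    show ?case
      using n k by (intro exI[of _ "max n k"]) (simp add: less_max_iff_disj)
  qed simp
  then obtain n where n: "\<And>\<chi> r s. \<chi> \<in> set \<Gamma> \<Longrightarrow> (\<forall>x<n. r x = s x) \<Longrightarrow> rename r \<chi> = rename s \<chi>"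
    by blast
  have "rename (Suc(n := 0)) \<chi> = lift \<chi> \<and> rename (Suc(n := 0)) (inst n \<chi>) = \<chi>"
    if "\<chi> \<in> set \<Gamma>" for \<chi>
  proof
    show "rename (Suc(n := 0)) \<chi> = lift \<chi>"
      using that by (intro n) simp_all
    have "rename (Suc(n := 0) \<circ> case_nat n id) \<chi> = rename id \<chi>"
      using that by (intro n) (auto split: nat.split)
    then show "rename (Suc(n := 0)) (inst n \<chi>) = \<chi>"
      by (simp add: rename_rename)
  qed
  then show ?thesis
    by blast
qed

section \<open>Structural rules of natural deduction\<close>

lemma natded_in_lang:
  assumes "natded L X \<Gamma> \<phi>"
  shows "in_lang L \<phi>" and "\<chi> \<in> set \<Gamma> \<Longrightarrow> in_lang L \<chi>"
proof -
  have "in_lang L \<phi> \<and> (\<forall>\<chi>\<in>set \<Gamma>. in_lang L \<chi>)"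
    using assms by (induction rule: natded.induct) auto
  then show "in_lang L \<phi>" and "\<chi> \<in> set \<Gamma> \<Longrightarrow> in_lang L \<chi>"
    by auto
qed

lemma natded_weaken:
  assumes "natded L X \<Gamma> \<phi>" "set \<Gamma> \<subseteq> set \<Delta>" "\<forall>\<chi>\<in>set \<Delta>. in_lang L \<chi>"
  shows "natded L X \<Delta> \<phi>"
  using assms
proof (induction arbitrary: \<Delta> rule: natded.induct)
  case (OrE \<Gamma> \<phi> \<psi> \<chi>)
  then have "in_lang L \<phi>" "in_lang L \<psi>"
    using natded_in_lang(1)[of L X \<Gamma> "Or \<phi> \<psi>"] by auto
  then show ?case
    using OrE by (intro natded.OrE[of L X \<Delta> \<phi> \<psi> \<chi>] OrE.IH) auto
next
  case (ImpI \<phi> \<Gamma> \<psi>)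
  then show ?case
    using natded_in_lang(2)[OF ImpI.hyps] by (intro natded.ImpI ImpI.IH) auto
next
  case (NegI \<phi> \<Gamma> \<psi>)
  then show ?case
    using natded_in_lang(2)[OF NegI.hyps(1)] by (intro natded.NegI[OF NegI.IH]) auto
next
  case (ForallI \<Gamma> \<phi>)
  then show ?case
    by (intro natded.ForallI ForallI.IH) auto
next
  case (ExistsE \<Gamma> \<phi> \<psi>)
  then show ?case
    using natded_in_lang(2)[OF ExistsE.hyps(2)]
    by (intro natded.ExistsE[of L X \<Delta> \<phi> \<psi>] ExistsE.IH) auto
next
  case (AndE1 \<Gamma> \<phi> \<psi>)
  then show ?case
    by (metis natded.AndE1)
next
  case (AndE2 \<Gamma> \<phi> \<psi>)
  then show ?case
    by (metis natded.AndE2)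
next
  case (ImpE \<Gamma> \<phi> \<psi>)
  then show ?case
    by (metis natded.ImpE)
next
  case (NegE \<Gamma> \<phi> \<psi>)
  then show ?case
    by (metis natded.NegE)
next
  case (ExistsI \<Gamma> x \<phi>)
  then show ?case
    by (metis natded.ExistsI)
next
  case (EqE \<Gamma> x y \<phi>)
  then show ?case
    by (metis natded.EqE)
next
  case (ForallE \<Gamma> \<phi> x)
  then show ?case
    by (simp add: natded.ForallE)
qed (auto intro: natded.Assm natded.Extra natded.AndI natded.OrI1 natded.OrI2 natded.EqI)

lemma natded_cut:
  assumes "natded L X \<Gamma> \<phi>" "natded L X (\<phi> # \<Gamma>) \<psi>"
  shows "natded L X \<Gamma> \<psi>"
  by (rule natded.ImpE[OF natded.ImpI[OF assms(2)] assms(1)])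

lemma natded_rename:
  assumes "natded L X \<Gamma> \<phi>" "\<And>r \<chi>. \<chi> \<in> X \<Longrightarrow> rename r \<chi> \<in> X"
  shows "natded L X (map (rename r) \<Gamma>) (rename r \<phi>)"
  using assms(1)
proof (induction arbitrary: r rule: natded.induct)
  case (Extra \<Gamma> \<phi>)
  then show ?case
    using assms(2) by (intro natded.Extra) auto
next
  case (ForallI \<Gamma> \<phi>)
  from ForallI.IH[of "under_binder r"] show ?case
    by (simp add: natded.ForallI comp_def rename_under_binder_lift)
next
  case (ForallE \<Gamma> \<phi> x)
  from ForallE.IH[of r] show ?case
    unfolding rename_inst rename.simps by (rule natded.ForallE)
next
  case (ExistsI \<Gamma> x \<phi>)
  from ExistsI.IH[of r] show ?case
    unfolding rename_inst rename.simps by (rule natded.ExistsI)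
next
  case (ExistsE \<Gamma> \<phi> \<psi>)
  show ?case
    by (rule natded.ExistsE[of L X _ "rename (under_binder r) \<phi>"])
      (use ExistsE.IH(1)[of r] ExistsE.IH(2)[of "under_binder r"] in
        \<open>simp_all add: comp_def rename_under_binder_lift\<close>)
next
  case (OrE \<Gamma> \<phi> \<psi> \<chi>)
  from natded.OrE[of L X _ "rename r \<phi>" "rename r \<psi>"] OrE.IH[of r] show ?case
    by simp
next
  case (NegI \<phi> \<Gamma> \<psi>)
  from natded.NegI[of L X "rename r \<phi>" _ "rename r \<psi>"] NegI.IH[of r] show ?case
    by simp
next
  case (EqE \<Gamma> x y \<phi>)
  show ?case
    using natded.EqE[OF EqE.IH(1)[of r, unfolded rename.simps]
        EqE.IH(2)[of r, unfolded rename_inst]]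
    unfolding rename_inst .
next
  case (AndE1 \<Gamma> \<phi> \<psi>)
  from AndE1.IH[of r] show ?case
    by (auto dest: natded.AndE1)
next
  case (AndE2 \<Gamma> \<phi> \<psi>)
  from AndE2.IH[of r] show ?case
    by (auto dest: natded.AndE2)
next
  case (ImpE \<Gamma> \<phi> \<psi>)
  from ImpE.IH[of r] show ?case
    by (auto dest: natded.ImpE)
next
  case (NegE \<Gamma> \<phi> \<psi>)
  from natded.NegE[of L X _ "rename r \<phi>" "rename r \<psi>"] NegE.IH[of r] NegE.hyps(3) show ?case
    by simp
next
  case (Assm \<Gamma> \<phi>)
  then show ?case
    by (intro natded.Assm) auto
next
  case (EqI \<Gamma> x)
  then show ?case
    by (simp add: natded.EqI)
qed (auto intro: natded.AndI natded.OrI1 natded.OrI2 natded.ImpI)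

lemma in_lang_mono:
  assumes "in_lang L \<phi>" "rels L \<subseteq> rels L'" "ident L = ident L'"
  shows "in_lang L' \<phi>"
  using assms by (induction \<phi>) auto

lemma natded_mono_lang:
  assumes "natded L X \<Gamma> \<phi>" "rels L \<subseteq> rels L'" "ident L = ident L'"
  shows "natded L' X \<Gamma> \<phi>"
  using assms(1)
proof (induction rule: natded.induct)
  case (OrE \<Gamma> \<phi> \<psi> \<chi>)
  then show ?case
    by (metis natded.OrE)
next
  case (NegI \<phi> \<Gamma> \<psi>)
  then show ?case
    by (metis natded.NegI)
next
  case (ExistsE \<Gamma> \<phi> \<psi>)
  then show ?case
    by (metis natded.ExistsE)
next
  case (ExistsI \<Gamma> x \<phi>)
  then show ?case
    by (metis natded.ExistsI)
next
  case (EqE \<Gamma> x y \<phi>)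
  then show ?case
    by (metis natded.EqE)
next
  case (NegE \<Gamma> \<phi> \<psi>)
  then show ?case
    by (metis natded.NegE in_lang_mono[OF _ assms(2,3)])
next
  case (AndE1 \<Gamma> \<phi> \<psi>)
  then show ?case
    by (metis natded.AndE1)
next
  case (AndE2 \<Gamma> \<phi> \<psi>)
  then show ?case
    by (metis natded.AndE2)
next
  case (ImpE \<Gamma> \<phi> \<psi>)
  then show ?case
    by (metis natded.ImpE)
next
  case (ForallE \<Gamma> \<phi> x)
  then show ?case
    by (simp add: natded.ForallE)
qed (use assms(3) in \<open>auto intro: natded.Assm natded.Extra natded.AndI natded.OrI1 natded.OrI2
    natded.ImpI natded.ForallI natded.EqI in_lang_mono[OF _ assms(2,3)]\<close>)

section \<open>Deduction in the bimodal system\<close>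

lemma bm_thm_in_mlang: "bm_thm L X \<phi> \<Longrightarrow> in_mlang L \<phi>"
  by (induction rule: bm_thm.induct) simp_all

text \<open>
  Necessitation and generalization apply to theorems only, so derivability from hypotheses is
  theoremhood of a curried implication. The innermost hypothesis is the head of the list, which
  makes the deduction theorem hold by definition.
\<close>

definition entails :: "'p lang \<Rightarrow> 'p mfm set \<Rightarrow> 'p mfm list \<Rightarrow> 'p mfm \<Rightarrow> bool" where
  "entails L X \<Gamma> \<phi> \<longleftrightarrow> bm_thm L X (fold MImp \<Gamma> \<phi>)"

context
  fixes L :: "'p lang" and X :: "'p mfm set"
begin

abbreviation ent (infix "\<tturnstile>" 50) where "\<Gamma> \<tturnstile> \<phi> \<equiv> entails L X \<Gamma> \<phi>"
abbreviation wff where "wff \<equiv> in_mlang L"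

lemma entails_Nil: "[] \<tturnstile> \<phi> \<longleftrightarrow> bm_thm L X \<phi>"
  by (simp add: entails_def)

lemma ent_impI: "\<phi> # \<Gamma> \<tturnstile> \<psi> \<Longrightarrow> \<Gamma> \<tturnstile> \<phi> \<^bold>\<rightarrow> \<psi>"
  and ent_impD: "\<Gamma> \<tturnstile> \<phi> \<^bold>\<rightarrow> \<psi> \<Longrightarrow> \<phi> # \<Gamma> \<tturnstile> \<psi>"
  by (simp_all add: entails_def)

lemma bm_thm_imp_iff: "bm_thm L X (\<phi> \<^bold>\<rightarrow> \<psi>) \<longleftrightarrow> [\<phi>] \<tturnstile> \<psi>"
  by (simp add: entails_def)

lemma fold_MImp_in_mlang: "wff (fold MImp \<Gamma> \<phi>) \<longleftrightarrow> wff \<phi> \<and> (\<forall>\<chi>\<in>set \<Gamma>. wff \<chi>)"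
  by (induction \<Gamma> arbitrary: \<phi>) auto

lemma entails_wf: "\<Gamma> \<tturnstile> \<phi> \<Longrightarrow> wff \<phi>"
  and entails_wf_hyps: "\<Gamma> \<tturnstile> \<phi> \<Longrightarrow> \<forall>\<chi>\<in>set \<Gamma>. wff \<chi>"
  by (auto simp: entails_def fold_MImp_in_mlang dest!: bm_thm_in_mlang)

lemma ent_thmI: "bm_thm L X \<phi> \<Longrightarrow> \<forall>\<chi>\<in>set \<Gamma>. wff \<chi> \<Longrightarrow> \<Gamma> \<tturnstile> \<phi>"
proof (induction \<Gamma> arbitrary: \<phi>)
  case (Cons \<chi> \<Gamma>)
  have "bm_thm L X (\<phi> \<^bold>\<rightarrow> \<chi> \<^bold>\<rightarrow> \<phi>)"
    using Cons.prems bm_thm_in_mlang by (auto intro!: bm_thm.Ax bm_axiom.P1)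
  then have "bm_thm L X (\<chi> \<^bold>\<rightarrow> \<phi>)"
    using Cons.prems(1) by (rule bm_thm.MP)
  then have "\<Gamma> \<tturnstile> \<chi> \<^bold>\<rightarrow> \<phi>"
    using Cons.prems(2) by (intro Cons.IH) simp_all
  then show ?case
    by (rule ent_impD)
qed (simp add: entails_Nil)

lemma ent_axI: "bm_axiom \<phi> \<Longrightarrow> wff \<phi> \<Longrightarrow> \<forall>\<chi>\<in>set \<Gamma>. wff \<chi> \<Longrightarrow> \<Gamma> \<tturnstile> \<phi>"
  by (intro ent_thmI bm_thm.Ax)

lemma ent_mp: "\<Gamma> \<tturnstile> \<phi> \<^bold>\<rightarrow> \<psi> \<Longrightarrow> \<Gamma> \<tturnstile> \<phi> \<Longrightarrow> \<Gamma> \<tturnstile> \<psi>"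
proof (induction \<Gamma> arbitrary: \<phi> \<psi>)
  case Nil
  then show ?case
    unfolding entails_Nil by (rule bm_thm.MP)
next
  case (Cons \<chi> \<Gamma>)
  have imps: "\<Gamma> \<tturnstile> \<chi> \<^bold>\<rightarrow> \<phi> \<^bold>\<rightarrow> \<psi>" "\<Gamma> \<tturnstile> \<chi> \<^bold>\<rightarrow> \<phi>"
    using Cons.prems by (simp_all add: ent_impI)
  then have "\<Gamma> \<tturnstile> (\<chi> \<^bold>\<rightarrow> \<phi> \<^bold>\<rightarrow> \<psi>) \<^bold>\<rightarrow> (\<chi> \<^bold>\<rightarrow> \<phi>) \<^bold>\<rightarrow> \<chi> \<^bold>\<rightarrow> \<psi>"
    using entails_wf[OF imps(1)] entails_wf_hyps[OF imps(1)] by (intro ent_axI bm_axiom.P2) auto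
  from Cons.IH[OF Cons.IH[OF this imps(1)] imps(2)] have "\<Gamma> \<tturnstile> \<chi> \<^bold>\<rightarrow> \<psi>" .
  then show ?case
    by (rule ent_impD)
qed

lemma ent_thm_mp: "bm_thm L X (\<phi> \<^bold>\<rightarrow> \<psi>) \<Longrightarrow> \<Gamma> \<tturnstile> \<phi> \<Longrightarrow> \<Gamma> \<tturnstile> \<psi>"
  by (rule ent_mp[OF ent_thmI]) (auto dest: entails_wf_hyps)

lemma ent_ax_mp: "bm_axiom (\<phi> \<^bold>\<rightarrow> \<psi>) \<Longrightarrow> \<Gamma> \<tturnstile> \<phi> \<Longrightarrow> wff \<psi> \<Longrightarrow> \<Gamma> \<tturnstile> \<psi>"
  by (rule ent_thm_mp[OF bm_thm.Ax]) (auto dest: entails_wf)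

lemma ent_assm: "\<phi> \<in> set \<Gamma> \<Longrightarrow> \<forall>\<chi>\<in>set \<Gamma>. wff \<chi> \<Longrightarrow> \<Gamma> \<tturnstile> \<phi>"
proof (induction \<Gamma>)
  case (Cons \<chi> \<Gamma>)
  show ?case
  proof (cases "\<phi> \<in> set \<Gamma>")
    case True
    with Cons have "\<Gamma> \<tturnstile> \<phi>"
      by simp
    then have "\<Gamma> \<tturnstile> \<chi> \<^bold>\<rightarrow> \<phi>"
      using Cons.prems by (intro ent_ax_mp[OF bm_axiom.P1[of \<phi> \<chi>]]) (auto dest: entails_wf)
    then show ?thesis
      by (rule ent_impD)
  next
    case False
    with Cons.prems have [simp]: "\<chi> = \<phi>" and wff: "wff \<phi>" "\<forall>\<chi>\<in>set \<Gamma>. wff \<chi>"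
      by auto
    have "\<Gamma> \<tturnstile> \<phi> \<^bold>\<rightarrow> (\<phi> \<^bold>\<rightarrow> \<phi>) \<^bold>\<rightarrow> \<phi>" "\<Gamma> \<tturnstile> \<phi> \<^bold>\<rightarrow> \<phi> \<^bold>\<rightarrow> \<phi>"
      using wff by (auto intro!: ent_axI bm_axiom.P1)
    moreover have "\<Gamma> \<tturnstile> (\<phi> \<^bold>\<rightarrow> (\<phi> \<^bold>\<rightarrow> \<phi>) \<^bold>\<rightarrow> \<phi>) \<^bold>\<rightarrow> (\<phi> \<^bold>\<rightarrow> \<phi> \<^bold>\<rightarrow> \<phi>) \<^bold>\<rightarrow> \<phi> \<^bold>\<rightarrow> \<phi>"
      using wff by (auto intro!: ent_axI bm_axiom.P2)
    ultimately have "\<Gamma> \<tturnstile> \<phi> \<^bold>\<rightarrow> \<phi>"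
      using ent_mp by metis
    then show ?thesis
      by (simp add: ent_impD)
  qed
qed simp

lemma ent_weaken: "\<Gamma> \<tturnstile> \<phi> \<Longrightarrow> set \<Gamma> \<subseteq> set \<Delta> \<Longrightarrow> \<forall>\<chi>\<in>set \<Delta>. wff \<chi> \<Longrightarrow> \<Delta> \<tturnstile> \<phi>"
proof (induction \<Gamma> arbitrary: \<phi>)
  case (Cons \<chi> \<Gamma>)
  have "\<Delta> \<tturnstile> \<chi> \<^bold>\<rightarrow> \<phi>"
    by (rule Cons.IH[OF ent_impI]) (use Cons.prems in auto)
  then show ?case
    by (rule ent_mp[OF _ ent_assm]) (use Cons.prems in auto)
qed (simp add: entails_Nil ent_thmI)

lemma ent_andI: "\<Gamma> \<tturnstile> \<phi> \<Longrightarrow> \<Gamma> \<tturnstile> \<psi> \<Longrightarrow> \<Gamma> \<tturnstile> \<phi> \<^bold>\<and> \<psi>"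
  by (rule ent_mp[OF ent_ax_mp[OF bm_axiom.P3]]) (auto dest: entails_wf)

lemma ent_andD1: "\<Gamma> \<tturnstile> \<phi> \<^bold>\<and> \<psi> \<Longrightarrow> \<Gamma> \<tturnstile> \<phi>"
  by (rule ent_ax_mp[OF bm_axiom.P4]) (auto dest: entails_wf)

lemma ent_andD2: "\<Gamma> \<tturnstile> \<phi> \<^bold>\<and> \<psi> \<Longrightarrow> \<Gamma> \<tturnstile> \<psi>"
  by (rule ent_ax_mp[OF bm_axiom.P5]) (auto dest: entails_wf)

lemma ent_orI1: "\<Gamma> \<tturnstile> \<phi> \<Longrightarrow> wff \<psi> \<Longrightarrow> \<Gamma> \<tturnstile> \<phi> \<^bold>\<or> \<psi>"
  by (rule ent_ax_mp[OF bm_axiom.P6]) (auto dest: entails_wf)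

lemma ent_orI2: "\<Gamma> \<tturnstile> \<psi> \<Longrightarrow> wff \<phi> \<Longrightarrow> \<Gamma> \<tturnstile> \<phi> \<^bold>\<or> \<psi>"
  by (rule ent_ax_mp[OF bm_axiom.P7]) (auto dest: entails_wf)

lemma ent_orE:
  assumes "\<Gamma> \<tturnstile> \<phi> \<^bold>\<or> \<psi>" "\<phi> # \<Gamma> \<tturnstile> \<chi>" "\<psi> # \<Gamma> \<tturnstile> \<chi>"
  shows "\<Gamma> \<tturnstile> \<chi>"
  by (rule ent_mp[OF ent_mp[OF ent_ax_mp[OF bm_axiom.P8 ent_impI[OF assms(2)]]
          ent_impI[OF assms(3)]] assms(1)])
    (use assms in \<open>auto dest!: entails_wf\<close>)

lemma ent_notI:
  assumes "\<phi> # \<Gamma> \<tturnstile> \<psi>" "\<phi> # \<Gamma> \<tturnstile> \<^bold>\<not> \<psi>"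
  shows "\<Gamma> \<tturnstile> \<^bold>\<not> \<phi>"
  by (rule ent_mp[OF ent_ax_mp[OF bm_axiom.P9 ent_impI[OF assms(1)]] ent_impI[OF assms(2)]])
    (use assms entails_wf_hyps[OF assms(1)] in \<open>auto dest!: entails_wf\<close>)

lemma ent_notnotD: "\<Gamma> \<tturnstile> \<^bold>\<not> \<^bold>\<not> \<phi> \<Longrightarrow> \<Gamma> \<tturnstile> \<phi>"
  by (rule ent_ax_mp[OF bm_axiom.P10]) (auto dest: entails_wf)

lemma ent_ccontr: "\<^bold>\<not> \<phi> # \<Gamma> \<tturnstile> \<psi> \<Longrightarrow> \<^bold>\<not> \<phi> # \<Gamma> \<tturnstile> \<^bold>\<not> \<psi> \<Longrightarrow> \<Gamma> \<tturnstile> \<phi>"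
  by (rule ent_notnotD[OF ent_notI])

lemma ent_notE:
  assumes "\<Gamma> \<tturnstile> \<^bold>\<not> \<phi>" "\<Gamma> \<tturnstile> \<phi>" "wff \<psi>"
  shows "\<Gamma> \<tturnstile> \<psi>"
  by (rule ent_ccontr[OF ent_weaken[OF assms(2)] ent_weaken[OF assms(1)]])
    (use assms(3) entails_wf_hyps[OF assms(1)] in auto)

lemma ent_contrapos:
  assumes "\<phi> # \<Gamma> \<tturnstile> \<psi>"
  shows "\<^bold>\<not> \<psi> # \<Gamma> \<tturnstile> \<^bold>\<not> \<phi>"
  by (rule ent_notI[OF ent_weaken[OF assms]])
    (use entails_wf[OF assms] entails_wf_hyps[OF assms] in \<open>auto simp: ent_assm\<close>)

lemma bm_thm_trans:
  assumes "bm_thm L X (\<phi> \<^bold>\<rightarrow> \<psi>)" "bm_thm L X (\<psi> \<^bold>\<rightarrow> \<chi>)"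
  shows "bm_thm L X (\<phi> \<^bold>\<rightarrow> \<chi>)"
  using assms(1) unfolding bm_thm_imp_iff[of \<phi>] by (rule ent_thm_mp[OF assms(2)])

lemma bm_thm_contrapos: "bm_thm L X (\<phi> \<^bold>\<rightarrow> \<psi>) \<Longrightarrow> bm_thm L X (\<^bold>\<not> \<psi> \<^bold>\<rightarrow> \<^bold>\<not> \<phi>)"
  unfolding bm_thm_imp_iff by (rule ent_contrapos)

lemma ent_allD: "\<Gamma> \<tturnstile> MForall \<phi> \<Longrightarrow> \<Gamma> \<tturnstile> minst x \<phi>"
  by (rule ent_ax_mp[OF bm_axiom.Q1]) (auto dest: entails_wf)

lemma ent_exI: "\<Gamma> \<tturnstile> minst x \<phi> \<Longrightarrow> \<Gamma> \<tturnstile> MExists \<phi>"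
  by (rule ent_ax_mp[OF bm_axiom.Q2]) (auto dest: entails_wf)

lemma bm_thm_MForall: "bm_thm L X \<phi> \<Longrightarrow> bm_thm L X (MForall \<phi>)"
proof -
  assume \<phi>: "bm_thm L X \<phi>"
  then have wff: "wff \<phi>"
    by (rule bm_thm_in_mlang)
  \<comment> \<open>Generalization needs an antecedent; any theorem will do.\<close>
  let ?c = "MForall \<phi> \<^bold>\<rightarrow> MForall \<phi>"
  have "[] \<tturnstile> mlift ?c \<^bold>\<rightarrow> \<phi>"
    using \<phi> wff by (intro ent_impI ent_thmI) simp_all
  then have "bm_thm L X (?c \<^bold>\<rightarrow> MForall \<phi>)"
    unfolding entails_Nil by (rule bm_thm.Gen_Forall)
  moreover have "[] \<tturnstile> ?c"
    using wff by (intro ent_impI ent_assm) simp_all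
  ultimately show ?thesis
    unfolding entails_Nil by (rule bm_thm.MP)
qed

text \<open>
  The quantifier axioms and \<open>Gen_Forall\<close> allow the hypotheses to be moved out of the scope of the
  quantifier one at a time.
\<close>

lemma ent_allI: "map mlift \<Gamma> \<tturnstile> \<phi> \<Longrightarrow> \<Gamma> \<tturnstile> MForall \<phi>"
proof (induction \<Gamma> arbitrary: \<phi>)
  case (Cons \<chi> \<Gamma>)
  then have "map mlift \<Gamma> \<tturnstile> mlift \<chi> \<^bold>\<rightarrow> \<phi>"
    by (simp add: ent_impI)
  then have all: "\<Gamma> \<tturnstile> MForall (mlift \<chi> \<^bold>\<rightarrow> \<phi>)"
    by (rule Cons.IH)
  then have wff: "wff \<chi>" "wff \<phi>"
    by (auto dest: entails_wf)
  let ?c = "\<chi> \<^bold>\<and> MForall (mlift \<chi> \<^bold>\<rightarrow> \<phi>)"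
  have "[mlift ?c] \<tturnstile> mlift ?c"
    using wff by (intro ent_assm) simp_all
  then have c: "[mlift ?c] \<tturnstile> mlift \<chi> \<^bold>\<and> MForall (mrename (under_binder Suc) (mlift \<chi> \<^bold>\<rightarrow> \<phi>))"
    by simp
  from ent_allD[OF ent_andD2[OF c], of 0] have "[mlift ?c] \<tturnstile> mlift \<chi> \<^bold>\<rightarrow> \<phi>"
    unfolding minst_0_lift_under_binder .
  from ent_mp[OF this ent_andD1[OF c]]
  have "bm_thm L X (?c \<^bold>\<rightarrow> MForall \<phi>)"
    by (intro bm_thm.Gen_Forall) (simp add: bm_thm_imp_iff)
  then show ?case
    by (rule ent_thm_mp[OF _ ent_andI[OF ent_assm ent_weaken[OF all]]])
      (use wff entails_wf_hyps[OF all] in auto)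
qed (simp add: entails_Nil bm_thm_MForall)

lemma ent_exE:
  assumes "\<Gamma> \<tturnstile> MExists \<phi>" "\<phi> # map mlift \<Gamma> \<tturnstile> mlift \<psi>"
  shows "\<Gamma> \<tturnstile> \<psi>"
proof -
  let ?c = "MForall (\<phi> \<^bold>\<rightarrow> mlift \<psi>)"
  have all: "\<Gamma> \<tturnstile> ?c"
    using assms(2) by (intro ent_allI ent_impI)
  then have wff: "wff \<phi>" "wff \<psi>"
    by (auto dest: entails_wf)
  have "[mlift ?c, \<phi>] \<tturnstile> mlift ?c"
    using wff by (intro ent_assm) simp_all
  then have "[mlift ?c, \<phi>] \<tturnstile> MForall (mrename (under_binder Suc) (\<phi> \<^bold>\<rightarrow> mlift \<psi>))"
    by simp
  from ent_allD[OF this, of 0]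
  have "[mlift ?c, \<phi>] \<tturnstile> \<phi> \<^bold>\<rightarrow> mlift \<psi>"
    unfolding minst_0_lift_under_binder .
  then have "[mlift ?c, \<phi>] \<tturnstile> mlift \<psi>"
    by (rule ent_mp) (use wff in \<open>simp add: ent_assm\<close>)
  then have "[\<phi>] \<tturnstile> mlift (?c \<^bold>\<rightarrow> \<psi>)"
    by (simp add: ent_impI)
  then have "bm_thm L X (MExists \<phi> \<^bold>\<rightarrow> ?c \<^bold>\<rightarrow> \<psi>)"
    unfolding bm_thm_imp_iff[symmetric] by (rule bm_thm.Gen_Exists)
  from ent_thm_mp[OF this assms(1)] all show ?thesis
    by (rule ent_mp)
qed

section \<open>Stable and dense formulas\<close>

lemma ent_boxD: "\<Gamma> \<tturnstile> Box m \<phi> \<Longrightarrow> \<Gamma> \<tturnstile> \<phi>"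
  by (rule ent_ax_mp[OF bm_axiom.T]) (auto dest: entails_wf)

lemma ent_box_mp: "\<Gamma> \<tturnstile> Box m (\<phi> \<^bold>\<rightarrow> \<psi>) \<Longrightarrow> \<Gamma> \<tturnstile> Box m \<phi> \<Longrightarrow> \<Gamma> \<tturnstile> Box m \<psi>"
  by (rule ent_mp[OF ent_ax_mp[OF bm_axiom.K[of m \<phi> \<psi>]]]) (auto dest: entails_wf)

text \<open>
  A formula that is stable for a modality may occur among the hypotheses of a necessitation.
\<close>

definition stable :: "modality \<Rightarrow> 'p mfm \<Rightarrow> bool" where
  "stable m \<phi> \<longleftrightarrow> bm_thm L X (\<phi> \<^bold>\<rightarrow> Box m \<phi>)"

lemma stable_wf: "stable m \<phi> \<Longrightarrow> wff \<phi>"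
  unfolding stable_def by (auto dest: bm_thm_in_mlang)

lemma ent_boxI_stable: "\<Gamma> \<tturnstile> \<phi> \<Longrightarrow> \<forall>\<chi>\<in>set \<Gamma>. stable m \<chi> \<Longrightarrow> \<Gamma> \<tturnstile> Box m \<phi>"
proof (induction \<Gamma> arbitrary: \<phi>)
  case Nil
  then show ?case
    by (simp add: entails_Nil bm_thm.Nec)
next
  case (Cons \<chi> \<Gamma>)
  have "\<Gamma> \<tturnstile> Box m (\<chi> \<^bold>\<rightarrow> \<phi>)"
    by (rule Cons.IH[OF ent_impI]) (use Cons.prems in auto)
  then have "\<chi> # \<Gamma> \<tturnstile> Box m (\<chi> \<^bold>\<rightarrow> \<phi>)"
    by (rule ent_weaken) (use Cons.prems(2) in \<open>auto dest: stable_wf\<close>)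
  moreover have "\<chi> # \<Gamma> \<tturnstile> Box m \<chi>"
    by (rule ent_thm_mp[OF _ ent_assm[of \<chi>]])
      (use Cons.prems(2) in \<open>auto simp: stable_wf stable_def[symmetric]\<close>)
  ultimately show ?case
    by (rule ent_box_mp)
qed

lemma bm_thm_box_mono: "bm_thm L X (\<phi> \<^bold>\<rightarrow> \<psi>) \<Longrightarrow> bm_thm L X (Box m \<phi> \<^bold>\<rightarrow> Box m \<psi>)"
proof -
  assume \<phi>: "bm_thm L X (\<phi> \<^bold>\<rightarrow> \<psi>)"
  have "[Box m \<phi>] \<tturnstile> Box m \<psi>"
    by (rule ent_box_mp[OF ent_thmI[OF bm_thm.Nec[OF \<phi>]] ent_assm])
      (use bm_thm_in_mlang[OF \<phi>] in auto)
  then show ?thesis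
    by (simp add: bm_thm_imp_iff)
qed

lemma bm_thm_dia_mono: "bm_thm L X (\<phi> \<^bold>\<rightarrow> \<psi>) \<Longrightarrow> bm_thm L X (Dia m \<phi> \<^bold>\<rightarrow> Dia m \<psi>)"
  by (intro bm_thm_contrapos bm_thm_box_mono)

lemma stableI: "[\<phi>] \<tturnstile> Box m \<phi> \<Longrightarrow> stable m \<phi>"
  by (simp add: stable_def bm_thm_imp_iff)

lemma stable_box: "wff \<phi> \<Longrightarrow> stable m (Box m \<phi>)"
  by (auto simp: stable_def intro: bm_thm.Ax bm_axiom.Four)

lemma stable_D_imp_G: "stable D \<phi> \<Longrightarrow> stable G \<phi>"
  unfolding stable_def
  by (rule bm_thm_trans, assumption)
    (auto intro!: bm_thm.Ax bm_axiom.Subsumption dest: bm_thm_in_mlang)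

text \<open>
  The contrapositive of \<open>Dia G \<phi> \<^bold>\<rightarrow> \<phi>\<close> is a stability condition, so that density, too, can be used
  and established by \<open>ent_boxI_stable\<close>.
\<close>

abbreviation dense :: "'p mfm \<Rightarrow> bool" where
  "dense \<phi> \<equiv> stable G (\<^bold>\<not> \<phi>)"

lemma dense_iff: "dense \<phi> \<longleftrightarrow> bm_thm L X (Dia G \<phi> \<^bold>\<rightarrow> \<phi>)"
proof
  assume \<phi>: "dense \<phi>"
  have "[Dia G \<phi>] \<tturnstile> \<phi>"
    by (rule ent_ccontr[OF ent_thm_mp[OF \<phi>[unfolded stable_def] ent_assm] ent_assm])
      (use stable_wf[OF \<phi>] in auto)
  then show "bm_thm L X (Dia G \<phi> \<^bold>\<rightarrow> \<phi>)"
    by (simp add: bm_thm_imp_iff)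
next
  assume \<phi>: "bm_thm L X (Dia G \<phi> \<^bold>\<rightarrow> \<phi>)"
  have "[\<^bold>\<not> \<phi>] \<tturnstile> \<^bold>\<not> Dia G \<phi>"
    using \<phi> unfolding bm_thm_imp_iff by (rule ent_contrapos)
  then show "dense \<phi>"
    by (rule stableI[OF ent_notnotD])
qed

text \<open>
  By the axiom \<open>Mixed2\<close>: if \<open>Box D \<phi>\<close> is \<open>G\<close>-possible, then \<open>\<phi>\<close> is \<open>D\<close>-necessarily
  \<open>G\<close>-possible, hence \<open>D\<close>-necessarily true.
\<close>

lemma dense_box_D:
  assumes "dense \<phi>"
  shows "dense (Box D \<phi>)"
proof -
  have "wff \<phi>"
    using stable_wf[OF assms] by simp
  then have "bm_thm L X (Dia G (Box D \<phi>) \<^bold>\<rightarrow> Box D (Dia G \<phi>))"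
    by (intro bm_thm.Ax bm_axiom.Mixed2) simp
  then show ?thesis
    using bm_thm_trans bm_thm_box_mono[OF assms[unfolded dense_iff]] unfolding dense_iff by metis
qed

lemma dense_atom:
  assumes "bm_thm L X (Dia G \<phi> \<^bold>\<rightarrow> Box G \<phi>)"
  shows "dense \<phi>"
  unfolding dense_iff
  by (rule bm_thm_trans[OF assms])
    (use bm_thm_in_mlang[OF assms] in \<open>auto intro: bm_thm.Ax bm_axiom.T\<close>)

lemma ent_cut_list: "\<Delta> \<tturnstile> \<psi> \<Longrightarrow> \<forall>\<chi>\<in>set \<Delta>. \<Gamma> \<tturnstile> \<chi> \<Longrightarrow> \<forall>\<chi>\<in>set \<Gamma>. wff \<chi> \<Longrightarrow> \<Gamma> \<tturnstile> \<psi>"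
proof (induction \<Delta> arbitrary: \<psi>)
  case (Cons \<chi> \<Delta>)
  have "\<Gamma> \<tturnstile> \<chi> \<^bold>\<rightarrow> \<psi>"
    by (rule Cons.IH[OF ent_impI]) (use Cons.prems in auto)
  then show ?case
    by (rule ent_mp) (use Cons.prems in auto)
qed (simp add: entails_Nil ent_thmI)

lemma stable_and:
  assumes "stable m \<phi>" "stable m \<psi>"
  shows "stable m (\<phi> \<^bold>\<and> \<psi>)"
proof -
  have wff: "wff \<phi>" "wff \<psi>"
    using assms by (auto dest: stable_wf)
  then have "[\<phi>, \<psi>] \<tturnstile> \<phi> \<^bold>\<and> \<psi>"
    by (simp add: ent_andI ent_assm)
  then have box: "[\<phi>, \<psi>] \<tturnstile> Box m (\<phi> \<^bold>\<and> \<psi>)"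
    using assms by (simp add: ent_boxI_stable)
  have conj: "[\<phi> \<^bold>\<and> \<psi>] \<tturnstile> \<phi> \<^bold>\<and> \<psi>"
    using wff by (simp add: ent_assm)
  show ?thesis
    by (rule stableI[OF ent_cut_list[OF box]])
      (use ent_andD1[OF conj] ent_andD2[OF conj] wff in simp_all)
qed

lemma stable_or:
  assumes "stable m \<phi>" "stable m \<psi>"
  shows "stable m (\<phi> \<^bold>\<or> \<psi>)"
proof -
  have wff: "wff \<phi>" "wff \<psi>"
    using assms by (auto dest: stable_wf)
  let ?\<theta> = "\<phi> \<^bold>\<or> \<psi>"
  have "[\<phi>] \<tturnstile> Box m ?\<theta>"
    by (rule ent_boxI_stable[OF ent_orI1]) (use assms wff in \<open>simp_all add: ent_assm\<close>)
  then have 1: "[\<phi>, ?\<theta>] \<tturnstile> Box m ?\<theta>"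
    by (rule ent_weaken) (use wff in auto)
  have "[\<psi>] \<tturnstile> Box m ?\<theta>"
    by (rule ent_boxI_stable[OF ent_orI2]) (use assms wff in \<open>simp_all add: ent_assm\<close>)
  then have 2: "[\<psi>, ?\<theta>] \<tturnstile> Box m ?\<theta>"
    by (rule ent_weaken) (use wff in auto)
  have "[?\<theta>] \<tturnstile> ?\<theta>"
    using wff by (simp add: ent_assm)
  from stableI[OF ent_orE[OF this 1 2]] show ?thesis .
qed

lemma stable_notnot:
  assumes "stable m \<phi>"
  shows "stable m (\<^bold>\<not> \<^bold>\<not> \<phi>)"
proof -
  have wff: "wff \<phi>"
    using assms by (rule stable_wf)
  have "[\<phi>] \<tturnstile> \<^bold>\<not> \<^bold>\<not> \<phi>"
    by (rule ent_notI[of _ _ \<phi>]) (use wff in \<open>simp_all add: ent_assm\<close>)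
  then have box: "[\<phi>] \<tturnstile> Box m (\<^bold>\<not> \<^bold>\<not> \<phi>)"
    using assms by (simp add: ent_boxI_stable)
  have "[\<^bold>\<not> \<^bold>\<not> \<phi>] \<tturnstile> \<phi>"
    by (rule ent_notnotD) (use wff in \<open>simp add: ent_assm\<close>)
  then show ?thesis
    by (intro stableI[OF ent_cut_list[OF box]]) (use wff in simp_all)
qed

lemma ex_lift: "wff \<phi> \<Longrightarrow> [\<phi>] \<tturnstile> mlift (MExists \<phi>)"
  using ent_exI[of "[\<phi>]" 0 "mrename (under_binder Suc) \<phi>"] by (simp add: ent_assm)

lemma all_lift: "wff \<phi> \<Longrightarrow> [mlift (MForall \<phi>)] \<tturnstile> \<phi>"
  using ent_allD[of "[mlift (MForall \<phi>)]" "mrename (under_binder Suc) \<phi>" 0] by (simp add: ent_assm)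

text \<open>
  An instance of \<open>\<phi>\<close> is stable and implies \<open>MExists \<phi>\<close>, hence it implies \<open>Box m (MExists \<phi>)\<close>.
\<close>

lemma stable_ex:
  assumes "stable m \<phi>"
  shows "stable m (MExists \<phi>)"
proof -
  have wff: "wff \<phi>"
    using assms by (rule stable_wf)
  have "[\<phi>] \<tturnstile> Box m (mlift (MExists \<phi>))"
    using assms wff by (intro ent_boxI_stable ex_lift) simp_all
  then have "\<phi> # map mlift [MExists \<phi>] \<tturnstile> mlift (Box m (MExists \<phi>))"
    unfolding mrename.simps(9) by (rule ent_weaken) (use wff in auto)
  then have "[MExists \<phi>] \<tturnstile> Box m (MExists \<phi>)"
    by (rule ent_exE[rotated]) (use wff in \<open>simp add: ent_assm\<close>)
  then show ?thesis
    by (rule stableI)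
qed

text \<open>
  The axiom \<open>Mixed2\<close> again: a \<open>D\<close>-stable formula that is \<open>G\<close>-possible is \<open>G\<close>-possibly \<open>D\<close>-necessary,
  hence \<open>D\<close>-necessarily \<open>G\<close>-possible.
\<close>

lemma stable_dia_G:
  assumes "stable D \<phi>"
  shows "stable D (Dia G \<phi>)"
proof -
  have "bm_thm L X (Dia G \<phi> \<^bold>\<rightarrow> Dia G (Box D \<phi>))"
    using assms unfolding stable_def by (rule bm_thm_dia_mono)
  moreover have "bm_thm L X (Dia G (Box D \<phi>) \<^bold>\<rightarrow> Box D (Dia G \<phi>))"
    using stable_wf[OF assms] by (intro bm_thm.Ax bm_axiom.Mixed2) simp
  ultimately show ?thesis
    unfolding stable_def by (rule bm_thm_trans)
qed

lemma star_stable: "in_lang L \<phi> \<Longrightarrow> stable D (star \<phi>)"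
  by (induction \<phi>) (simp_all add: stable_box stable_and stable_or stable_ex stable_dia_G)

lemma dense_and:
  assumes "dense \<phi>" "dense \<psi>"
  shows "dense (\<phi> \<^bold>\<and> \<psi>)"
proof -
  have wff: "wff \<phi>" "wff \<psi>"
    using assms by (auto dest: stable_wf)
  have conj: "[\<phi> \<^bold>\<and> \<psi>] \<tturnstile> \<phi> \<^bold>\<and> \<psi>"
    using wff by (simp add: ent_assm)
  have "bm_thm L X (\<phi> \<^bold>\<and> \<psi> \<^bold>\<rightarrow> \<phi>)" "bm_thm L X (\<phi> \<^bold>\<and> \<psi> \<^bold>\<rightarrow> \<psi>)"
    using ent_andD1[OF conj] ent_andD2[OF conj] by (simp_all add: bm_thm_imp_iff)
  then have "bm_thm L X (Dia G (\<phi> \<^bold>\<and> \<psi>) \<^bold>\<rightarrow> \<phi>)" "bm_thm L X (Dia G (\<phi> \<^bold>\<and> \<psi>) \<^bold>\<rightarrow> \<psi>)"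
    using assms bm_thm_trans[OF bm_thm_dia_mono] by (auto simp: dense_iff)
  then show ?thesis
    unfolding dense_iff bm_thm_imp_iff by (rule ent_andI)
qed

lemma dense_or:
  assumes "dense \<phi>" "dense \<psi>"
  shows "dense (\<phi> \<^bold>\<or> \<psi>)"
proof -
  have wff: "wff \<phi>" "wff \<psi>"
    using assms by (auto dest: stable_wf)
  let ?\<Gamma> = "[\<phi> \<^bold>\<or> \<psi>, \<^bold>\<not> \<phi>, \<^bold>\<not> \<psi>]"
  have "?\<Gamma> \<tturnstile> \<phi>"
  proof (rule ent_orE[of ?\<Gamma> \<phi> \<psi>])
    show "\<psi> # ?\<Gamma> \<tturnstile> \<phi>"
      by (rule ent_notE[of _ \<psi>]) (use wff in \<open>simp_all add: ent_assm\<close>)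
  qed (use wff in \<open>simp_all add: ent_assm\<close>)
  then have "[\<^bold>\<not> \<phi>, \<^bold>\<not> \<psi>] \<tturnstile> \<^bold>\<not> (\<phi> \<^bold>\<or> \<psi>)"
    by (rule ent_notI) (use wff in \<open>simp add: ent_assm\<close>)
  then have box: "[\<^bold>\<not> \<phi>, \<^bold>\<not> \<psi>] \<tturnstile> Box G (\<^bold>\<not> (\<phi> \<^bold>\<or> \<psi>))"
    using assms by (intro ent_boxI_stable) simp_all
  have "[\<^bold>\<not> (\<phi> \<^bold>\<or> \<psi>)] \<tturnstile> \<^bold>\<not> \<phi>" "[\<^bold>\<not> (\<phi> \<^bold>\<or> \<psi>)] \<tturnstile> \<^bold>\<not> \<psi>"
    using wff by (simp_all add: ent_contrapos ent_orI1 ent_orI2 ent_assm)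
  then have "[\<^bold>\<not> (\<phi> \<^bold>\<or> \<psi>)] \<tturnstile> Box G (\<^bold>\<not> (\<phi> \<^bold>\<or> \<psi>))"
    using wff by (intro ent_cut_list[OF box]) simp_all
  then show ?thesis
    by (rule stableI)
qed

text \<open>
  The hypotheses \<open>\<phi>\<close> and \<open>\<^bold>\<not> \<psi>\<close>, to which \<open>\<^bold>\<not> (\<phi> \<^bold>\<rightarrow> \<psi>)\<close> is equivalent, are both stable for \<open>G\<close>.
\<close>

lemma dense_imp:
  assumes "stable G \<phi>" "dense \<psi>"
  shows "dense (\<phi> \<^bold>\<rightarrow> \<psi>)"
proof -
  have wff: "wff \<phi>" "wff \<psi>"
    using assms by (auto dest: stable_wf)
  have "[\<phi> \<^bold>\<rightarrow> \<psi>, \<phi>, \<^bold>\<not> \<psi>] \<tturnstile> \<psi>"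
    by (rule ent_mp[of _ \<phi>]) (use wff in \<open>simp_all add: ent_assm\<close>)
  then have "[\<phi>, \<^bold>\<not> \<psi>] \<tturnstile> \<^bold>\<not> (\<phi> \<^bold>\<rightarrow> \<psi>)"
    by (rule ent_notI) (use wff in \<open>simp add: ent_assm\<close>)
  then have box: "[\<phi>, \<^bold>\<not> \<psi>] \<tturnstile> Box G (\<^bold>\<not> (\<phi> \<^bold>\<rightarrow> \<psi>))"
    using assms by (intro ent_boxI_stable) simp_all
  have "[\<phi>, \<^bold>\<not> \<phi>, \<^bold>\<not> (\<phi> \<^bold>\<rightarrow> \<psi>)] \<tturnstile> \<psi>"
    by (rule ent_notE[of _ \<phi>]) (use wff in \<open>simp_all add: ent_assm\<close>)
  from ent_impI[OF this] have "[\<^bold>\<not> (\<phi> \<^bold>\<rightarrow> \<psi>)] \<tturnstile> \<phi>"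
    by (rule ent_ccontr) (use wff in \<open>simp add: ent_assm\<close>)
  moreover have "[\<phi>, \<psi>] \<tturnstile> \<psi>"
    using wff by (simp add: ent_assm)
  from ent_contrapos[OF ent_impI[OF this]] have "[\<^bold>\<not> (\<phi> \<^bold>\<rightarrow> \<psi>)] \<tturnstile> \<^bold>\<not> \<psi>" .
  ultimately have "[\<^bold>\<not> (\<phi> \<^bold>\<rightarrow> \<psi>)] \<tturnstile> Box G (\<^bold>\<not> (\<phi> \<^bold>\<rightarrow> \<psi>))"
    using wff by (intro ent_cut_list[OF box]) simp_all
  then show ?thesis
    by (rule stableI)
qed

text \<open>
  A universal formula implies its instances, so \<open>Dia G\<close> can be moved inside the quantifier.
\<close>

lemma dense_all:
  assumes "dense \<phi>"
  shows "dense (MForall \<phi>)"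
proof -
  have "wff \<phi>"
    using stable_wf[OF assms] by simp
  then have "bm_thm L X (Dia G (mlift (MForall \<phi>)) \<^bold>\<rightarrow> Dia G \<phi>)"
    using all_lift by (intro bm_thm_dia_mono) (simp only: bm_thm_imp_iff)
  from bm_thm_trans[OF this assms[unfolded dense_iff]]
  have "bm_thm L X (mlift (Dia G (MForall \<phi>)) \<^bold>\<rightarrow> \<phi>)"
    by simp
  then show ?thesis
    unfolding dense_iff by (rule bm_thm.Gen_Forall)
qed

lemma star_dense: "in_lang L \<phi> \<Longrightarrow> dense (star \<phi>)"
proof (induction \<phi>)
  case (Rel p xs)
  then show ?case
    by (simp add: dense_box_D dense_atom bm_thm.Ax bm_axiom.Stab_Rel)
next
  case (Eq x y)
  then show ?case
    by (simp add: dense_box_D dense_atom bm_thm.Ax bm_axiom.Stab_Eq)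
next
  case (Neg \<phi>)
  then show ?case
    by (simp add: dense_box_D stable_notnot stable_D_imp_G star_stable)
next
  case (Imp \<phi> \<psi>)
  then show ?case
    by (simp add: dense_box_D dense_imp stable_D_imp_G star_stable)
next
  case (Exists \<phi>)
  then show ?case
    by (simp add: stable_notnot stable_box)
qed (simp_all add: dense_and dense_or dense_box_D dense_all)

section \<open>The translation preserves derivability\<close>

lemma ent_boxI_star: "map star \<Gamma> \<tturnstile> \<phi> \<Longrightarrow> map star \<Gamma> \<tturnstile> Box D \<phi>"
  by (rule ent_boxI_stable) (auto dest: entails_wf_hyps simp: star_stable)

lemma ent_diaI:
  assumes "\<Gamma> \<tturnstile> \<phi>"
  shows "\<Gamma> \<tturnstile> Dia m \<phi>"
proof -
  have wff: "wff \<phi>" "\<forall>\<chi>\<in>set \<Gamma>. wff \<chi>"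
    using entails_wf[OF assms] entails_wf_hyps[OF assms] by auto
  have "Box m (\<^bold>\<not> \<phi>) # \<Gamma> \<tturnstile> \<^bold>\<not> \<phi>"
    by (rule ent_boxD[of _ m]) (use wff in \<open>simp add: ent_assm\<close>)
  moreover have "Box m (\<^bold>\<not> \<phi>) # \<Gamma> \<tturnstile> \<phi>"
    using assms by (rule ent_weaken) (use wff in auto)
  ultimately show ?thesis
    by (rule ent_notI[rotated])
qed

text \<open>
  The clause of the translation for \<open>Exists\<close> is harmless since the conclusion \<open>star \<psi>\<close> is dense: its
  negation is a stable hypothesis, so a refutation of \<open>\<phi>\<close> from it can be boxed.
\<close>

lemma ent_diaE_star:
  assumes "map star \<Gamma> \<tturnstile> Dia G \<phi>" "\<phi> # map star \<Gamma> \<tturnstile> star \<psi>"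
  shows "map star \<Gamma> \<tturnstile> star \<psi>"
proof -
  have wff: "in_lang L \<psi>" "\<forall>\<chi>\<in>set \<Gamma>. in_lang L \<chi>"
    using entails_wf[OF assms(2)] entails_wf_hyps[OF assms(1)] by auto
  have "\<^bold>\<not> star \<psi> # map star \<Gamma> \<tturnstile> Box G (\<^bold>\<not> \<phi>)"
    by (rule ent_boxI_stable[OF ent_contrapos[OF assms(2)]])
      (use wff in \<open>auto simp: star_dense star_stable stable_D_imp_G\<close>)
  moreover have "\<^bold>\<not> star \<psi> # map star \<Gamma> \<tturnstile> Dia G \<phi>"
    by (rule ent_weaken[OF assms(1)]) (use wff in auto)
  ultimately show ?thesis
    by (rule ent_ccontr)
qed

theorem natded_imp_entails_star:
  assumes "natded L Y \<Gamma> \<phi>"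
    and "\<And>\<chi>. \<chi> \<in> Y \<Longrightarrow> in_lang L \<chi> \<Longrightarrow> bm_thm L X (star \<chi>)"
  shows "map star \<Gamma> \<tturnstile> star \<phi>"
  using assms(1)
proof (induction rule: natded.induct)
  case (Assm \<Gamma> \<phi>)
  then show ?case
    by (intro ent_assm) auto
next
  case (Extra \<Gamma> \<phi>)
  then show ?case
    by (intro ent_thmI assms(2)) auto
next
  case (AndI \<Gamma> \<phi> \<psi>)
  then show ?case
    by (simp add: ent_andI)
next
  case (AndE1 \<Gamma> \<phi> \<psi>)
  from ent_andD1[OF AndE1.IH[simplified]] show ?case .
next
  case (AndE2 \<Gamma> \<phi> \<psi>)
  from ent_andD2[OF AndE2.IH[simplified]] show ?case .
next
  case (OrI1 \<Gamma> \<phi> \<psi>)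
  then show ?case
    by (simp add: ent_orI1)
next
  case (OrI2 \<Gamma> \<psi> \<phi>)
  then show ?case
    by (simp add: ent_orI2)
next
  case (OrE \<Gamma> \<phi> \<psi> \<chi>)
  from ent_orE[OF OrE.IH[simplified]] show ?case .
next
  case (ImpI \<phi> \<Gamma> \<psi>)
  then show ?case
    by (simp add: ent_boxI_star ent_impI)
next
  case (ImpE \<Gamma> \<phi> \<psi>)
  from ent_mp[OF ent_boxD[OF ImpE.IH(1)[simplified]] ImpE.IH(2)] show ?case .
next
  case (NegI \<phi> \<Gamma> \<psi>)
  from ent_notI[OF NegI.IH(1)[simplified] ent_boxD[OF NegI.IH(2)[simplified]]] show ?case
    by (simp add: ent_boxI_star)
next
  case (NegE \<Gamma> \<phi> \<psi>)
  from ent_notE[OF ent_boxD[OF NegE.IH(1)[simplified]] NegE.IH(2)] NegE.hyps(3) show ?case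
    by simp
next
  case (ForallI \<Gamma> \<phi>)
  then have "map mlift (map star \<Gamma>) \<tturnstile> star \<phi>"
    by (simp add: comp_def star_rename)
  then show ?case
    by (simp add: ent_boxI_star ent_allI)
next
  case (ForallE \<Gamma> \<phi> x)
  from ent_allD[OF ent_boxD[OF ForallE.IH[simplified]]] show ?case
    by (simp add: star_rename)
next
  case (ExistsI \<Gamma> x \<phi>)
  from ent_diaI[OF ent_exI[OF ExistsI.IH[unfolded star_rename]]] show ?case
    by simp
next
  case (ExistsE \<Gamma> \<phi> \<psi>)
  have wff: "in_lang L \<phi>" "\<forall>\<chi>\<in>set \<Gamma>. in_lang L \<chi>"
    using natded_in_lang[OF ExistsE.hyps(1)] by auto
  have "star \<phi> # map mlift (map star \<Gamma>) \<tturnstile> mlift (star \<psi>)"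
    using ExistsE.IH(2) by (simp add: comp_def star_rename)
  then have "star \<phi> # map mlift (MExists (star \<phi>) # map star \<Gamma>) \<tturnstile> mlift (star \<psi>)"
    by (rule ent_weaken) (use wff in auto)
  then have "MExists (star \<phi>) # map star \<Gamma> \<tturnstile> star \<psi>"
    by (rule ent_exE[rotated]) (use wff in \<open>auto simp: ent_assm\<close>)
  with ExistsE.IH(1)[simplified] show ?case
    by (rule ent_diaE_star)
next
  case (EqI \<Gamma> x)
  then show ?case
    by (auto intro!: ent_thmI bm_thm.Nec bm_thm.Ax bm_axiom.I1)
next
  case (EqE \<Gamma> x y \<phi>)
  have wff: "ident L" "in_lang L \<phi>"
    using natded_in_lang[OF EqE.hyps(1)] natded_in_lang[OF EqE.hyps(2)] by auto
  then have "bm_thm L X (MEq x y \<^bold>\<rightarrow> minst x (star \<phi>) \<^bold>\<rightarrow> minst y (star \<phi>))"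
    by (intro bm_thm.Ax bm_axiom.I2) simp
  from ent_mp[OF ent_thm_mp[OF this ent_boxD[OF EqE.IH(1)[simplified]]]
      EqE.IH(2)[unfolded star_rename]]
  show ?case
    unfolding star_rename .
qed

text \<open>
  Density gives \<open>Box G (\<^bold>\<not> star \<phi>)\<close> from \<open>\<^bold>\<not> star \<phi>\<close>, and Reverse Subsumption makes this the
  translation of \<open>Neg \<phi>\<close>.
\<close>

lemma star_excluded_middle:
  assumes "\<And>\<phi>. wff \<phi> \<Longrightarrow> bm_thm L X (Box G \<phi> \<^bold>\<rightarrow> Box D \<phi>)" "in_lang L \<phi>"
  shows "bm_thm L X (star (Or \<phi> (Neg \<phi>)))"
proof -
  let ?\<theta> = "star (Or \<phi> (Neg \<phi>))"
  have "[star \<phi>, \<^bold>\<not> ?\<theta>] \<tturnstile> ?\<theta>"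
    using assms(2) by (simp add: ent_orI1 ent_assm)
  then have "[\<^bold>\<not> ?\<theta>] \<tturnstile> \<^bold>\<not> star \<phi>"
    by (rule ent_notI) (use assms(2) in \<open>simp add: ent_assm\<close>)
  then have "[\<^bold>\<not> ?\<theta>] \<tturnstile> Box D (\<^bold>\<not> star \<phi>)"
    by (rule ent_thm_mp[OF bm_thm_trans[OF star_dense[unfolded stable_def]], rotated 2])
      (use assms in simp_all)
  then have "[\<^bold>\<not> ?\<theta>] \<tturnstile> ?\<theta>"
    using assms(2) by (simp add: ent_orI2)
  then have "[] \<tturnstile> ?\<theta>"
    by (rule ent_ccontr) (use assms(2) in \<open>simp add: ent_assm\<close>)
  then show ?thesis
    by (simp add: entails_Nil)
qed

lemma foldl_MAnd_entails:
  "\<forall>\<chi>\<in>set (\<phi> # \<Gamma>). wff \<chi> \<Longrightarrow> \<chi> \<in> set (\<phi> # \<Gamma>) \<Longrightarrow> [foldl MAnd \<phi> \<Gamma>] \<tturnstile> \<chi>"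
proof (induction \<Gamma> arbitrary: \<phi> \<chi>)
  case Nil
  then show ?case
    by (simp add: ent_assm)
next
  case (Cons \<psi> \<Gamma>)
  have IH: "[foldl MAnd (\<phi> \<^bold>\<and> \<psi>) \<Gamma>] \<tturnstile> \<chi>" if "\<chi> \<in> set ((\<phi> \<^bold>\<and> \<psi>) # \<Gamma>)" for \<chi>
    using Cons.prems(1) that by (intro Cons.IH) auto
  then have "[foldl MAnd (\<phi> \<^bold>\<and> \<psi>) \<Gamma>] \<tturnstile> \<phi> \<^bold>\<and> \<psi>"
    by simp
  then show ?case
    using Cons.prems(2) IH by (auto dest: ent_andD1 ent_andD2)
qed

lemma conj_imp_if_entails: "\<Gamma> \<tturnstile> \<psi> \<Longrightarrow> bm_thm L X (conj_imp \<Gamma> \<psi>)"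
proof (cases \<Gamma>)
  case (Cons \<phi> \<Delta>)
  assume "\<Gamma> \<tturnstile> \<psi>"
  then have "[foldl MAnd \<phi> \<Delta>] \<tturnstile> \<psi>"
  proof (rule ent_cut_list)
    show conj: "\<forall>\<chi>\<in>set \<Gamma>. [foldl MAnd \<phi> \<Delta>] \<tturnstile> \<chi>"
      using entails_wf_hyps[OF \<open>\<Gamma> \<tturnstile> \<psi>\<close>] Cons foldl_MAnd_entails by blast
    show "\<forall>\<chi>\<in>set [foldl MAnd \<phi> \<Delta>]. wff \<chi>"
      using conj Cons entails_wf_hyps[of "[foldl MAnd \<phi> \<Delta>]" \<phi>] by simp
  qed
  then show ?thesis
    by (simp add: Cons bm_thm_imp_iff)
qed (simp add: entails_Nil)

end

theorem BMFOL_star_if_IFOL: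
  assumes "IFOL L \<Gamma> \<psi>"
  shows "BMFOL L (map star \<Gamma>) (star \<psi>)"
  using assms unfolding IFOL_def BMFOL_def
  by (intro conj_imp_if_entails natded_imp_entails_star[where Y = "{}"]) simp_all

theorem BMFOL_RS_star_if_FOL:
  assumes "FOL L \<Gamma> \<psi>"
  shows "BMFOL_RS L (map star \<Gamma>) (star \<psi>)"
  unfolding BMFOL_RS_def
proof (rule conj_imp_if_entails[OF natded_imp_entails_star[OF assms[unfolded FOL_def]]])
  let ?RS = "{Box G \<phi> \<^bold>\<rightarrow> Box D \<phi> |\<phi>. True}"
  fix \<chi>
  assume "\<chi> \<in> {Or \<phi> (Neg \<phi>) |\<phi>. True}" "in_lang L \<chi>"
  then obtain \<phi> where \<phi>: "\<chi> = Or \<phi> (Neg \<phi>)" "in_lang L \<phi>"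
    by auto
  have "bm_thm L ?RS (Box G \<phi> \<^bold>\<rightarrow> Box D \<phi>)" if "in_mlang L \<phi>" for \<phi>
    using that by (intro bm_thm.Extra) auto
  then show "bm_thm L ?RS (star \<chi>)"
    unfolding \<phi>(1) using \<phi>(2) by (rule star_excluded_middle)
qed

section \<open>Saturated theories\<close>

text \<open>
  The witness condition refers to variables, which are the individuals of the model, and theories
  need not be complete. A theory that omits some formula of the language is consistent.
\<close>

definition saturated :: "'p lang \<Rightarrow> 'p fm set \<Rightarrow> 'p fm set \<Rightarrow> bool" where
  "saturated L X T \<longleftrightarrow>
    (\<forall>\<phi>\<in>T. in_lang L \<phi>) \<and> (\<exists>\<phi>. in_lang L \<phi> \<and> \<phi> \<notin> T) \<and>
    (\<forall>\<Gamma> \<phi>. set \<Gamma> \<subseteq> T \<longrightarrow> natded L X \<Gamma> \<phi> \<longrightarrow> \<phi> \<in> T) \<and>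
    (\<forall>\<phi> \<psi>. Or \<phi> \<psi> \<in> T \<longrightarrow> \<phi> \<in> T \<or> \<psi> \<in> T) \<and>
    (\<forall>\<phi>. Exists \<phi> \<in> T \<longrightarrow> (\<exists>x. inst x \<phi> \<in> T))"

instance fm :: (countable) countable
  by countable_datatype

text \<open>
  Only the predicate symbols in use have to be coded by numbers; the type of predicate symbols may
  be uncountable.
\<close>

lemma countable_in_lang:
  assumes "countable (rels L)"
  shows "countable {\<phi>. in_lang L \<phi>}"
proof -
  let ?P = "fst ` rels L"
  have P: "countable ?P"
    using assms by simp
  have set_fm: "set_fm \<phi> \<subseteq> ?P" if "in_lang L \<phi>" for \<phi>
    using that by (induction \<phi>) force+
  have "inj_on (map_fm (to_nat_on ?P)) {\<phi>. in_lang L \<phi>}"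
  proof (rule inj_onI)
    fix \<phi> \<psi>
    assume "\<phi> \<in> {\<phi>. in_lang L \<phi>}" "\<psi> \<in> {\<phi>. in_lang L \<phi>}"
      and eq: "map_fm (to_nat_on ?P) \<phi> = map_fm (to_nat_on ?P) \<psi>"
    then have "set_fm \<phi> \<subseteq> ?P" "set_fm \<psi> \<subseteq> ?P"
      using set_fm by simp_all
    then show "\<phi> = \<psi>"
      using P by (intro fm.inj_map_strong[OF _ eq]) (meson inj_on_to_nat_on inj_onD subsetD)
  qed
  then show ?thesis
    by (rule countable_image_inj_on[OF countableI_type])
qed

context
  fixes L :: "'p lang" and X :: "'p fm set"
  assumes X_rename: "\<And>r \<chi>. \<chi> \<in> X \<Longrightarrow> rename r \<chi> \<in> X"
begin

lemma natded_generalize: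
  assumes "\<And>x. natded L X \<Gamma> (inst x \<phi>)"
  shows "natded L X \<Gamma> (Forall \<phi>)"
proof -
  obtain a where a: "\<And>\<chi>. \<chi> \<in> set (\<phi> # \<Gamma>) \<Longrightarrow>
      rename (Suc(a := 0)) \<chi> = lift \<chi> \<and> rename (Suc(a := 0)) (inst a \<chi>) = \<chi>"
    using fresh_variable[of "\<phi> # \<Gamma>"] by blast
  have "natded L X (map (rename (Suc(a := 0))) \<Gamma>) (rename (Suc(a := 0)) (inst a \<phi>))"
    using assms X_rename by (rule natded_rename)
  moreover have "map (rename (Suc(a := 0))) \<Gamma> = map lift \<Gamma>"
    using a by simp
  ultimately have "natded L X (map lift \<Gamma>) \<phi>"
    using a[of \<phi>] by simp
  then show ?thesis
    by (rule natded.ForallI)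
qed

lemma natded_witness:
  assumes "Exists \<phi> \<in> set \<Gamma>" "\<And>x. natded L X (inst x \<phi> # \<Gamma>) \<psi>"
  shows "natded L X \<Gamma> \<psi>"
proof -
  obtain a where a: "\<And>\<chi>. \<chi> \<in> set (\<phi> # \<psi> # \<Gamma>) \<Longrightarrow>
      rename (Suc(a := 0)) \<chi> = lift \<chi> \<and> rename (Suc(a := 0)) (inst a \<chi>) = \<chi>"
    using fresh_variable[of "\<phi> # \<psi> # \<Gamma>"] by blast
  have "natded L X (map (rename (Suc(a := 0))) (inst a \<phi> # \<Gamma>)) (rename (Suc(a := 0)) \<psi>)"
    using assms(2) X_rename by (rule natded_rename)
  moreover have "map (rename (Suc(a := 0))) \<Gamma> = map lift \<Gamma>"
    using a by simp
  ultimately have "natded L X (\<phi> # map lift \<Gamma>) (lift \<psi>)"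
    using a[of \<phi>] a[of \<psi>] by simp
  moreover have "natded L X \<Gamma> (Exists \<phi>)"
    using assms(1) natded_in_lang(2)[OF assms(2)] by (intro natded.Assm) auto
  ultimately show ?thesis
    by (rule natded.ExistsE[rotated])
qed

text \<open>
  One step in the construction of a theory that does not prove \<open>\<psi>\<close>: add \<open>\<phi>\<close>, together with a
  witness if it is existential, unless that makes \<open>\<psi>\<close> derivable.
\<close>

lemma saturation_step:
  assumes "\<not> natded L X \<Delta> \<psi>" "\<forall>\<chi>\<in>set \<Delta>. in_lang L \<chi>" "in_lang L \<phi>"
  shows "\<exists>\<Delta>'. set \<Delta> \<subseteq> set \<Delta>' \<and> \<not> natded L X \<Delta>' \<psi> \<and> (\<forall>\<chi>\<in>set \<Delta>'. in_lang L \<chi>) \<and>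
    (\<phi> \<in> set \<Delta>' \<or> natded L X (\<phi> # \<Delta>) \<psi>) \<and>
    (\<forall>\<theta>. \<phi> = Exists \<theta> \<longrightarrow> \<phi> \<in> set \<Delta>' \<longrightarrow> (\<exists>x. inst x \<theta> \<in> set \<Delta>'))"
proof (cases "natded L X (\<phi> # \<Delta>) \<psi>")
  case True
  have "\<phi> \<notin> set \<Delta>"
  proof
    assume "\<phi> \<in> set \<Delta>"
    then have "natded L X \<Delta> \<psi>"
      using assms(2) by (intro natded_weaken[OF True]) auto
    with assms(1) show False ..
  qed
  with True assms show ?thesis
    by (intro exI[of _ \<Delta>]) auto
next
  case False
  show ?thesis
  proof (cases "\<exists>\<theta>. \<phi> = Exists \<theta>")
    case True
    then obtain \<theta> where \<theta>: "\<phi> = Exists \<theta>"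
      by blast
    then obtain x where "\<not> natded L X (inst x \<theta> # \<phi> # \<Delta>) \<psi>"
      using natded_witness[of \<theta> "\<phi> # \<Delta>" \<psi>] False by auto
    then show ?thesis
      using assms \<theta> by (intro exI[of _ "inst x \<theta> # \<phi> # \<Delta>"]) auto
  next
    case no_ex: False
    then show ?thesis
      using assms False by (intro exI[of _ "\<phi> # \<Delta>"]) auto
  qed
qed

text \<open>
  A Henkin construction. The limit theory is maximal among those that do
  not prove \<open>\<psi>\<close>, and this yields closure and primeness: two formulas left out both lead to \<open>\<psi>\<close>,
  hence so does their disjunction. The context stays finite at every step, so fresh variables are
  always available.
\<close>

theorem saturated_extension:
  assumes countable: "countable (rels L)"
    and \<Gamma>: "\<forall>\<chi>\<in>set \<Gamma>. in_lang L \<chi>"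
    and \<psi>: "in_lang L \<psi>" "\<not> natded L X \<Gamma> \<psi>"
  shows "\<exists>T. saturated L X T \<and> set \<Gamma> \<subseteq> T \<and> \<psi> \<notin> T"
proof -
  define enum where "enum = from_nat_into {\<phi>. in_lang L \<phi>}"
  have enum_range: "range enum = {\<phi>. in_lang L \<phi>}"
    unfolding enum_def using \<psi>(1) countable_in_lang[OF countable]
    by (intro range_from_nat_into) auto
  have enum_lang: "in_lang L (enum n)" for n
    using rangeI[of enum n] unfolding enum_range by simp
  have enum_surj: "\<exists>n. \<phi> = enum n" if "in_lang L \<phi>" for \<phi>
  proof -
    from that have "\<phi> \<in> range enum"
      unfolding enum_range by simp
    then show ?thesis
      by (auto simp only: image_iff)
  qed
  define P where "P \<Delta> \<longleftrightarrow> \<not> natded L X \<Delta> \<psi> \<and> (\<forall>\<chi>\<in>set \<Delta>. in_lang L \<chi>) \<and> set \<Gamma> \<subseteq> set \<Delta>" for \<Delta>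
  define Q where "Q n \<Delta> \<Delta>' \<longleftrightarrow> set \<Delta> \<subseteq> set \<Delta>' \<and> (enum n \<in> set \<Delta>' \<or> natded L X (enum n # \<Delta>) \<psi>) \<and>
    (\<forall>\<theta>. enum n = Exists \<theta> \<longrightarrow> enum n \<in> set \<Delta>' \<longrightarrow> (\<exists>x. inst x \<theta> \<in> set \<Delta>'))" for n \<Delta> \<Delta>'
  have "\<exists>f. \<forall>n. P (f n) \<and> Q n (f n) (f (Suc n))"
  proof (rule dependent_nat_choice[where P = "\<lambda>_. P" and Q = Q])
    show "\<exists>\<Delta>. P \<Delta>"
      using \<Gamma> \<psi>(2) by (intro exI[of _ \<Gamma>]) (simp add: P_def)
    fix \<Delta> n
    assume "P \<Delta>"
    then have \<Delta>: "\<not> natded L X \<Delta> \<psi>" "\<forall>\<chi>\<in>set \<Delta>. in_lang L \<chi>" "set \<Gamma> \<subseteq> set \<Delta>"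
      by (simp_all add: P_def)
    from saturation_step[OF this(1,2) enum_lang[of n]]
    show "\<exists>\<Delta>'. P \<Delta>' \<and> Q n \<Delta> \<Delta>'"
    proof (rule ex_forward)
      fix \<Delta>'
      assume step: "set \<Delta> \<subseteq> set \<Delta>' \<and> \<not> natded L X \<Delta>' \<psi> \<and> (\<forall>\<chi>\<in>set \<Delta>'. in_lang L \<chi>) \<and>
        (enum n \<in> set \<Delta>' \<or> natded L X (enum n # \<Delta>) \<psi>) \<and>
        (\<forall>\<theta>. enum n = Exists \<theta> \<longrightarrow> enum n \<in> set \<Delta>' \<longrightarrow> (\<exists>x. inst x \<theta> \<in> set \<Delta>'))"
      then have "set \<Gamma> \<subseteq> set \<Delta>'"
        using \<Delta>(3) by (meson order_trans)
      with step show "P \<Delta>' \<and> Q n \<Delta> \<Delta>'"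
        unfolding P_def Q_def by satx
    qed
  qed
  then obtain f where f: "P (f n) \<and> Q n (f n) (f (Suc n))" for n
    by metis
  have P: "\<not> natded L X (f n) \<psi>" "\<forall>\<chi>\<in>set (f n). in_lang L \<chi>" "set \<Gamma> \<subseteq> set (f n)" for n
    using f[of n] by (simp_all add: P_def)
  have grows: "set (f n) \<subseteq> set (f (Suc n))"
    and decides: "enum n \<in> set (f (Suc n)) \<or> natded L X (enum n # f n) \<psi>"
    and witnesses: "\<forall>\<theta>. enum n = Exists \<theta> \<longrightarrow> enum n \<in> set (f (Suc n)) \<longrightarrow>
      (\<exists>x. inst x \<theta> \<in> set (f (Suc n)))"
    for n
    using f[of n] unfolding Q_def by satx+
  have mono: "set (f m) \<subseteq> set (f n)" if "m \<le> n" for m n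
    using grows that by (rule lift_Suc_mono_le[of "\<lambda>n. set (f n)"])
  define T where "T = (\<Union>n. set (f n))"
  have finite_part: "\<exists>n. set \<Delta> \<subseteq> set (f n)" if "set \<Delta> \<subseteq> T" for \<Delta>
    using that
  proof (induction \<Delta>)
    case (Cons \<phi> \<Delta>)
    then obtain m n where "set \<Delta> \<subseteq> set (f m)" "\<phi> \<in> set (f n)"
      by (auto simp: T_def)
    then have "set (\<phi> # \<Delta>) \<subseteq> set (f (max m n))"
      using mono[of m "max m n"] mono[of n "max m n"] by auto
    then show ?case
      by blast
  qed simp
  have consistent: "\<not> natded L X \<Delta> \<psi>" if sub: "set \<Delta> \<subseteq> T" for \<Delta>
  proof
    assume \<Delta>: "natded L X \<Delta> \<psi>"
    obtain n where "set \<Delta> \<subseteq> set (f n)"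
      using finite_part[OF sub] ..
    then have "natded L X (f n) \<psi>"
      using P[of n] by (intro natded_weaken[OF \<Delta>]) auto
    with P[of n] show False
      by simp
  qed
  have decided: "\<phi> \<in> T \<or> (\<exists>\<Delta>. set \<Delta> \<subseteq> T \<and> natded L X (\<phi> # \<Delta>) \<psi>)" if lang: "in_lang L \<phi>" for \<phi>
  proof -
    obtain n where "\<phi> = enum n"
      using enum_surj[OF lang] ..
    moreover have "set (f (Suc n)) \<subseteq> T" "set (f n) \<subseteq> T"
      by (auto simp: T_def)
    ultimately show ?thesis
      using decides[of n] by auto
  qed
  have lang: "in_lang L \<phi>" if "\<phi> \<in> T" for \<phi>
    using that P by (auto simp: T_def)
  have closed: "\<phi> \<in> T" if \<Delta>: "set \<Delta> \<subseteq> T" "natded L X \<Delta> \<phi>" for \<Delta> \<phi>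
  proof (rule ccontr)
    assume "\<phi> \<notin> T"
    then obtain \<Delta>' where \<Delta>': "set \<Delta>' \<subseteq> T" "natded L X (\<phi> # \<Delta>') \<psi>"
      using decided natded_in_lang(1)[OF \<Delta>(2)] by blast
    have lang': "\<forall>\<chi>\<in>set (\<Delta> @ \<Delta>'). in_lang L \<chi>"
      using lang \<Delta>(1) \<Delta>'(1) by auto
    have "natded L X (\<Delta> @ \<Delta>') \<phi>"
      using lang' by (intro natded_weaken[OF \<Delta>(2)]) auto
    moreover have "natded L X (\<phi> # \<Delta> @ \<Delta>') \<psi>"
      using lang' natded_in_lang(1)[OF \<Delta>(2)] by (intro natded_weaken[OF \<Delta>'(2)]) auto
    ultimately have "natded L X (\<Delta> @ \<Delta>') \<psi>"
      by (rule natded_cut)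
    then show False
      using consistent[of "\<Delta> @ \<Delta>'"] \<Delta>(1) \<Delta>'(1) by simp
  qed
  have prime: "\<phi> \<in> T \<or> \<chi> \<in> T" if or: "Or \<phi> \<chi> \<in> T" for \<phi> \<chi>
  proof (rule ccontr)
    assume not_in: "\<not> (\<phi> \<in> T \<or> \<chi> \<in> T)"
    have comp: "in_lang L \<phi>" "in_lang L \<chi>"
      using lang[OF or] by simp_all
    with not_in obtain \<Delta> \<Delta>' where \<Delta>: "set \<Delta> \<subseteq> T" "natded L X (\<phi> # \<Delta>) \<psi>"
      and \<Delta>': "set \<Delta>' \<subseteq> T" "natded L X (\<chi> # \<Delta>') \<psi>"
      using decided by meson
    let ?\<Theta> = "Or \<phi> \<chi> # \<Delta> @ \<Delta>'"
    have lang': "\<forall>\<chi>\<in>set ?\<Theta>. in_lang L \<chi>"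
      using lang[OF or] lang \<Delta>(1) \<Delta>'(1) by auto
    have "natded L X ?\<Theta> (Or \<phi> \<chi>)"
      using lang' by (intro natded.Assm) auto
    moreover have "natded L X (\<phi> # ?\<Theta>) \<psi>"
      using lang' comp by (intro natded_weaken[OF \<Delta>(2)]) auto
    moreover have "natded L X (\<chi> # ?\<Theta>) \<psi>"
      using lang' comp by (intro natded_weaken[OF \<Delta>'(2)]) auto
    ultimately have "natded L X ?\<Theta> \<psi>"
      by (rule natded.OrE)
    then show False
      using consistent[of ?\<Theta>] or \<Delta>(1) \<Delta>'(1) by simp
  qed
  have witness: "\<exists>x. inst x \<theta> \<in> T" if ex: "Exists \<theta> \<in> T" for \<theta>
  proof -
    obtain n where n: "Exists \<theta> = enum n"
      using enum_surj[OF lang[OF ex]] ..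
    have "set (f n) \<subseteq> T"
      by (auto simp: T_def)
    then have "\<not> natded L X (enum n # f n) \<psi>"
      using consistent[of "enum n # f n"] ex n by simp
    then have "enum n \<in> set (f (Suc n))"
      using decides[of n] by simp
    with witnesses[of n] n[symmetric] obtain x where "inst x \<theta> \<in> set (f (Suc n))"
      by blast
    then show ?thesis
      by (auto simp: T_def)
  qed
  have "\<psi> \<notin> T"
    using consistent[of "[\<psi>]"] \<psi>(1) by (auto simp: natded.Assm)
  moreover have "set \<Gamma> \<subseteq> T"
    using P[of 0] by (auto simp: T_def)
  ultimately show ?thesis
    using lang closed prime witness \<psi>(1) unfolding saturated_def by blast
qed

end

section \<open>Topological semantics\<close>

text \<open>
  The points of the space \<open>W\<close> are theories, and the individuals are the variables of the object
  language, so an assignment \<open>e\<close> is a renaming. \<open>Box D\<close> is the interior operator for the basic open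
  sets \<open>{T \<in> W. set \<Gamma> \<subseteq> T}\<close>; finite lists of formulas rather than single formulas make these closed
  under intersection and include the whole space even if the language has no formulas.
\<close>

primrec holds :: "'p fm set set \<Rightarrow> (nat \<Rightarrow> nat) \<Rightarrow> 'p mfm \<Rightarrow> 'p fm set \<Rightarrow> bool" where
  "holds W e (MRel p xs) T = (Rel p (map e xs) \<in> T)"
| "holds W e (MEq x y) T = (Eq (e x) (e y) \<in> T)"
| "holds W e (\<^bold>\<not> \<phi>) T = (\<not> holds W e \<phi> T)"
| "holds W e (\<phi> \<^bold>\<and> \<psi>) T = (holds W e \<phi> T \<and> holds W e \<psi> T)"
| "holds W e (\<phi> \<^bold>\<or> \<psi>) T = (holds W e \<phi> T \<or> holds W e \<psi> T)"
| "holds W e (\<phi> \<^bold>\<rightarrow> \<psi>) T = (holds W e \<phi> T \<longrightarrow> holds W e \<psi> T)"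
| "holds W e (MForall \<phi>) T = (\<forall>a. holds W (case_nat a e) \<phi> T)"
| "holds W e (MExists \<phi>) T = (\<exists>a. holds W (case_nat a e) \<phi> T)"
| "holds W e (Box m \<phi>) T = (case m of
      D \<Rightarrow> \<exists>\<Gamma>. set \<Gamma> \<subseteq> T \<and> (\<forall>T'\<in>W. set \<Gamma> \<subseteq> T' \<longrightarrow> holds W e \<phi> T')
    | G \<Rightarrow> holds W e \<phi> T)"

lemma holds_mrename: "holds W e (mrename r \<phi>) T = holds W (e \<circ> r) \<phi> T"
proof (induction \<phi> arbitrary: e r T)
  case (Box m \<phi>)
  then show ?case
    by (cases m) simp_all
qed (simp_all add: inst_comp_under_binder)

lemma holds_minst: "holds W e (minst x \<phi>) T = holds W (case_nat (e x) e) \<phi> T"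
  by (simp add: holds_mrename comp_case_nat)

lemma holds_conj_imp:
  "holds W e (conj_imp \<Gamma> \<psi>) T \<longleftrightarrow> ((\<forall>\<chi>\<in>set \<Gamma>. holds W e \<chi> T) \<longrightarrow> holds W e \<psi> T)"
proof -
  have "holds W e (foldl MAnd \<phi> \<Delta>) T \<longleftrightarrow> (\<forall>\<chi>\<in>set (\<phi> # \<Delta>). holds W e \<chi> T)" for \<phi> \<Delta>
    by (induction \<Delta> arbitrary: \<phi>) auto
  then show ?thesis
    by (cases \<Gamma>) simp_all
qed

locale theories =
  fixes L :: "'p lang" and X :: "'p fm set" and W :: "'p fm set set"
  assumes saturated: "T \<in> W \<Longrightarrow> saturated L X T"
begin

lemma in_lang: "T \<in> W \<Longrightarrow> \<phi> \<in> T \<Longrightarrow> in_lang L \<phi>"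
  using saturated[of T] unfolding saturated_def by blast

lemma closed: "T \<in> W \<Longrightarrow> natded L X \<Gamma> \<phi> \<Longrightarrow> set \<Gamma> \<subseteq> T \<Longrightarrow> \<phi> \<in> T"
  using saturated[of T] unfolding saturated_def by blast

lemma consistent:
  assumes "T \<in> W" "Neg \<phi> \<in> T"
  shows "\<phi> \<notin> T"
proof
  assume \<phi>: "\<phi> \<in> T"
  obtain \<psi> where \<psi>: "in_lang L \<psi>" "\<psi> \<notin> T"
    using saturated[OF assms(1)] unfolding saturated_def by blast
  have "natded L X [Neg \<phi>, \<phi>] \<psi>"
    by (rule natded.NegE[OF natded.Assm[of _ _ "Neg \<phi>"] natded.Assm])
      (use \<psi>(1) in_lang[OF assms(1) \<phi>] in auto)
  then show False
    using closed[OF assms(1)] assms(2) \<phi> \<psi>(2) by simp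
qed

lemma Or_iff:
  assumes "T \<in> W" "in_lang L \<phi>" "in_lang L \<psi>"
  shows "Or \<phi> \<psi> \<in> T \<longleftrightarrow> \<phi> \<in> T \<or> \<psi> \<in> T"
proof -
  have "natded L X [\<phi>] (Or \<phi> \<psi>)" "natded L X [\<psi>] (Or \<phi> \<psi>)"
    using assms by (simp_all add: natded.OrI1 natded.OrI2 natded.Assm)
  then have "Or \<phi> \<psi> \<in> T" if "\<phi> \<in> T \<or> \<psi> \<in> T"
    using that closed[OF assms(1)] by (metis empty_subsetI insert_subset list.set)
  moreover have "\<phi> \<in> T \<or> \<psi> \<in> T" if "Or \<phi> \<psi> \<in> T"
    using saturated[OF assms(1)] that unfolding saturated_def by blast
  ultimately show ?thesis
    by blast
qed

lemma And_iff:
  assumes "T \<in> W" "in_lang L \<phi>" "in_lang L \<psi>"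
  shows "And \<phi> \<psi> \<in> T \<longleftrightarrow> \<phi> \<in> T \<and> \<psi> \<in> T"
proof -
  have "natded L X [And \<phi> \<psi>] (And \<phi> \<psi>)"
    using assms by (intro natded.Assm) auto
  then have "natded L X [And \<phi> \<psi>] \<phi>" "natded L X [And \<phi> \<psi>] \<psi>"
    by (rule natded.AndE1, rule natded.AndE2)
  moreover have "natded L X [\<phi>, \<psi>] (And \<phi> \<psi>)"
    using assms by (intro natded.AndI natded.Assm) auto
  ultimately show ?thesis
    using closed[OF assms(1)] by (metis empty_subsetI insert_subset list.set)
qed

lemma Exists_iff:
  assumes "T \<in> W" "in_lang L \<phi>"
  shows "Exists \<phi> \<in> T \<longleftrightarrow> (\<exists>x. inst x \<phi> \<in> T)"
proof -
  have "natded L X [inst x \<phi>] (Exists \<phi>)" for x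
    using assms(2) by (intro natded.ExistsI[of L X _ x] natded.Assm) auto
  then have "Exists \<phi> \<in> T" if "inst x \<phi> \<in> T" for x
    using that closed[OF assms(1)] by (metis empty_subsetI insert_subset list.set)
  moreover have "\<exists>x. inst x \<phi> \<in> T" if "Exists \<phi> \<in> T"
    using saturated[OF assms(1)] that unfolding saturated_def by blast
  ultimately show ?thesis
    by blast
qed

lemma Forall_inst:
  assumes "T \<in> W" "Forall \<phi> \<in> T"
  shows "inst x \<phi> \<in> T"
proof -
  have "natded L X [Forall \<phi>] (Forall \<phi>)"
    using in_lang[OF assms] by (intro natded.Assm) auto
  from closed[OF assms(1) natded.ForallE[OF this]] show ?thesis
    using assms(2) by simp
qed

lemma Imp_mp:
  assumes "T \<in> W" "Imp \<phi> \<psi> \<in> T" "\<phi> \<in> T"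
  shows "\<psi> \<in> T"
proof -
  have "natded L X [Imp \<phi> \<psi>, \<phi>] \<psi>"
    by (rule natded.ImpE[OF natded.Assm[of _ _ "Imp \<phi> \<psi>"] natded.Assm])
      (use in_lang[OF assms(1,2)] in auto)
  then show ?thesis
    using assms closed by simp
qed

lemma Eq_subst:
  assumes "T \<in> W" "Eq a b \<in> T" "inst a \<phi> \<in> T"
  shows "inst b \<phi> \<in> T"
proof -
  have lang: "\<forall>\<chi>\<in>set [Eq a b, inst a \<phi>]. in_lang L \<chi>"
    using in_lang[OF assms(1,2)] in_lang[OF assms(1,3)] by simp
  have "natded L X [Eq a b, inst a \<phi>] (Eq a b)" "natded L X [Eq a b, inst a \<phi>] (inst a \<phi>)"
    using lang by (simp_all add: natded.Assm)
  from natded.EqE[OF this] show ?thesis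
    using assms closed by simp
qed

lemma Eq_refl: "T \<in> W \<Longrightarrow> ident L \<Longrightarrow> Eq a a \<in> T"
  using closed[OF _ natded.EqI[of "[]"]] by simp

lemma Eq_subst_iff:
  assumes "T \<in> W" "Eq a b \<in> T"
  shows "inst a \<phi> \<in> T \<longleftrightarrow> inst b \<phi> \<in> T"
proof -
  have "ident L"
    using in_lang[OF assms] by simp
  then have "Eq b a \<in> T"
    using Eq_subst[OF assms, of "Eq 0 (Suc a)"] Eq_refl[OF assms(1)] by simp
  then show ?thesis
    using Eq_subst assms by blast
qed

text \<open>
  Indiscernibility extends from atomic to modal formulas because an equation in \<open>T\<close> belongs to all
  theories of the neighbourhood of \<open>T\<close> that it defines. The assignments may differ at many
  variables, but only by replacing \<open>a\<close> with \<open>b\<close>, so that a single equation suffices.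
\<close>

lemma holds_Eq_cong:
  assumes "T \<in> W" "Eq a b \<in> T" "\<And>x. e x = e' x \<or> e x = a \<and> e' x = b"
  shows "holds W e \<phi> T \<longleftrightarrow> holds W e' \<phi> T"
  using assms
proof (induction \<phi> arbitrary: e e' T)
  case (MRel p xs)
  \<comment> \<open>The template has the variable \<open>0\<close> at the places where \<open>a\<close> is to be replaced.\<close>
  let ?v = "\<lambda>x. if e x = e' x then Suc (e x) else 0"
  have "case_nat a id (?v x) = e x" "case_nat b id (?v x) = e' x" for x
    using MRel.prems(3)[of x] by auto
  then have insts: "inst a (Rel p (map ?v xs)) = Rel p (map e xs)"
    "inst b (Rel p (map ?v xs)) = Rel p (map e' xs)"
    by (simp_all add: comp_def)
  then show ?case
    using Eq_subst_iff[OF MRel.prems(1,2), of "Rel p (map ?v xs)"] unfolding insts by simp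
next
  case (MEq x y)
  let ?v = "\<lambda>x. if e x = e' x then Suc (e x) else 0"
  have "case_nat a id (?v x) = e x" "case_nat b id (?v x) = e' x" for x
    using MEq.prems(3)[of x] by auto
  then show ?case
    using Eq_subst_iff[OF MEq.prems(1,2), of "Eq (?v x) (?v y)"] by (simp del: if_split)
next
  case (MForall \<phi>)
  have "holds W (case_nat c e) \<phi> T \<longleftrightarrow> holds W (case_nat c e') \<phi> T" for c
    using MForall.prems by (intro MForall.IH) (auto split: nat.split)
  then show ?case
    by simp
next
  case (MExists \<phi>)
  have "holds W (case_nat c e) \<phi> T \<longleftrightarrow> holds W (case_nat c e') \<phi> T" for c
    using MExists.prems by (intro MExists.IH) (auto split: nat.split)
  then show ?case
    by simp
next
  case (Box m \<phi>)
  show ?case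
  proof (cases m)
    case D
    \<comment> \<open>Shrink the neighbourhood to the points at which the equation is true.\<close>
    have le: "holds W v (Box D \<phi>) T" if box: "holds W u (Box D \<phi>) T"
      and cong: "\<And>T'. T' \<in> W \<Longrightarrow> Eq a b \<in> T' \<Longrightarrow> holds W u \<phi> T' \<longleftrightarrow> holds W v \<phi> T'" for u v
    proof -
      obtain \<Gamma> where \<Gamma>: "set \<Gamma> \<subseteq> T" "\<And>T'. T' \<in> W \<Longrightarrow> set \<Gamma> \<subseteq> T' \<Longrightarrow> holds W u \<phi> T'"
        using box by auto
      have "\<forall>T'\<in>W. set (Eq a b # \<Gamma>) \<subseteq> T' \<longrightarrow> holds W v \<phi> T'"
      proof (intro ballI impI)
        fix T'
        assume "T' \<in> W" "set (Eq a b # \<Gamma>) \<subseteq> T'"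
        with \<Gamma>(2)[of T'] cong[of T'] show "holds W v \<phi> T'"
          by simp
      qed
      moreover have "set (Eq a b # \<Gamma>) \<subseteq> T"
        using \<Gamma>(1) Box.prems(2) by simp
      ultimately show ?thesis
        unfolding holds.simps modality.case by blast
    qed
    have cong: "holds W e \<phi> T' \<longleftrightarrow> holds W e' \<phi> T'" if "T' \<in> W" "Eq a b \<in> T'" for T'
      using that Box.prems(3) by (rule Box.IH)
    from le[OF _ cong] le[OF _ cong[symmetric]] D show ?thesis
      by blast
  next
    case G
    with Box.IH[OF Box.prems] show ?thesis
      by simp
  qed
next
  case (MNeg \<phi>)
  from MNeg.IH[OF MNeg.prems] show ?case
    by simp
next
  case (MAnd \<phi> \<psi>)
  from MAnd.IH(1)[OF MAnd.prems] MAnd.IH(2)[OF MAnd.prems] show ?case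
    by simp
next
  case (MOr \<phi> \<psi>)
  from MOr.IH(1)[OF MOr.prems] MOr.IH(2)[OF MOr.prems] show ?case
    by simp
next
  case (MImp \<phi> \<psi>)
  from MImp.IH(1)[OF MImp.prems] MImp.IH(2)[OF MImp.prems] show ?case
    by simp
qed

lemma bm_axiom_holds:
  assumes "bm_axiom \<phi>" "in_mlang L' \<phi>" "ident L' \<longrightarrow> ident L" "T \<in> W"
  shows "holds W e \<phi> T"
  using assms
proof (induction rule: bm_axiom.induct)
  case (Q1 \<phi> x)
  then show ?case
    by (simp add: holds_minst)
next
  case (Q2 x \<phi>)
  then show ?case
    by (auto simp: holds_minst)
next
  case (I1 x)
  then show ?case
    by (simp add: Eq_refl)
next
  case (I2 x y \<phi>)
  have "holds W (case_nat (e x) e) \<phi> T \<longleftrightarrow> holds W (case_nat (e y) e) \<phi> T" if "Eq (e x) (e y) \<in> T"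
    using that I2.prems(3) by (intro holds_Eq_cong) (auto split: nat.split)
  then show ?case
    by (simp add: holds_minst)
next
  case (K m \<phi> \<psi>)
  show ?case
  proof (cases m)
    case D
    have "\<exists>\<Theta>. set \<Theta> \<subseteq> T \<and> (\<forall>T'\<in>W. set \<Theta> \<subseteq> T' \<longrightarrow> holds W e \<psi> T')"
      if "set \<Gamma> \<subseteq> T" "\<forall>T'\<in>W. set \<Gamma> \<subseteq> T' \<longrightarrow> holds W e \<phi> T' \<longrightarrow> holds W e \<psi> T'"
        "set \<Delta> \<subseteq> T" "\<forall>T'\<in>W. set \<Delta> \<subseteq> T' \<longrightarrow> holds W e \<phi> T'" for \<Gamma> \<Delta>
      using that by (intro exI[of _ "\<Gamma> @ \<Delta>"]) simp
    with D show ?thesis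
      by auto
  qed simp
next
  case (T m \<phi>)
  then show ?case
    by (cases m) auto
next
  case (Four m \<phi>)
  then show ?case
    by (cases m) auto
qed auto

text \<open>
  Soundness. The modal language \<open>L'\<close> may have more predicate symbols than the language \<open>L\<close> of the
  theories: no atom with such a symbol belongs to any of them, so it is false everywhere. Only
  identity has to be shared.
\<close>

lemma bm_thm_holds:
  assumes "bm_thm L' Y \<phi>" "ident L' \<longrightarrow> ident L"
    and "\<And>\<phi> e T. \<phi> \<in> Y \<Longrightarrow> T \<in> W \<Longrightarrow> holds W e \<phi> T"
    and "T \<in> W"
  shows "holds W e \<phi> T"
  using assms(1,4)
proof (induction arbitrary: e T rule: bm_thm.induct)
  case (Ax \<phi>)
  then show ?case
    using assms(2) bm_axiom_holds by blast
next
  case (Extra \<phi>)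
  then show ?case
    using assms(3) by blast
next
  case (MP \<phi> \<psi>)
  then show ?case
    by simp
next
  case (Gen_Forall \<phi> \<psi>)
  then have "holds W (case_nat a e) (mlift \<phi> \<^bold>\<rightarrow> \<psi>) T" for a
    by blast
  then show ?case
    by (simp add: holds_mrename)
next
  case (Gen_Exists \<phi> \<psi>)
  then have "holds W (case_nat a e) (\<phi> \<^bold>\<rightarrow> mlift \<psi>) T" for a
    by blast
  then show ?case
    by (auto simp: holds_mrename)
next
  case (Nec \<phi> m)
  then show ?case
    by (cases m) (auto intro: exI[of _ "[]"])
qed

end

text \<open>
  The converses of the elimination rules, read in the space \<open>W\<close>: what is true throughout a
  neighbourhood of \<open>T\<close> is recorded in \<open>T\<close> by the corresponding compound formula. These are the
  conditions under which the connectives translated with \<open>Box D\<close> can be treated in the truth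
  lemma; they have different reasons in the intuitionistic and the classical case.
\<close>

locale canonical_model = theories +
  assumes ImpI: "T \<in> W \<Longrightarrow> in_lang L \<phi> \<Longrightarrow> in_lang L \<psi> \<Longrightarrow> set \<Gamma> \<subseteq> T \<Longrightarrow>
      (\<And>T'. T' \<in> W \<Longrightarrow> set \<Gamma> \<subseteq> T' \<Longrightarrow> \<phi> \<in> T' \<Longrightarrow> \<psi> \<in> T') \<Longrightarrow> Imp \<phi> \<psi> \<in> T"
    and NegI: "T \<in> W \<Longrightarrow> in_lang L \<phi> \<Longrightarrow> set \<Gamma> \<subseteq> T \<Longrightarrow>
      (\<And>T'. T' \<in> W \<Longrightarrow> set \<Gamma> \<subseteq> T' \<Longrightarrow> \<phi> \<notin> T') \<Longrightarrow> Neg \<phi> \<in> T"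
    and ForallI: "T \<in> W \<Longrightarrow> in_lang L \<phi> \<Longrightarrow> set \<Gamma> \<subseteq> T \<Longrightarrow>
      (\<And>T' x. T' \<in> W \<Longrightarrow> set \<Gamma> \<subseteq> T' \<Longrightarrow> inst x \<phi> \<in> T') \<Longrightarrow> Forall \<phi> \<in> T"
begin

lemma box_member_iff:
  assumes "T \<in> W"
    and elim: "\<And>T'. T' \<in> W \<Longrightarrow> \<chi> \<in> T' \<Longrightarrow> P T'"
    and intro: "\<And>\<Gamma>. set \<Gamma> \<subseteq> T \<Longrightarrow> (\<And>T'. T' \<in> W \<Longrightarrow> set \<Gamma> \<subseteq> T' \<Longrightarrow> P T') \<Longrightarrow> \<chi> \<in> T"
  shows "(\<exists>\<Gamma>. set \<Gamma> \<subseteq> T \<and> (\<forall>T'\<in>W. set \<Gamma> \<subseteq> T' \<longrightarrow> P T')) \<longleftrightarrow> \<chi> \<in> T"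
proof
  assume "\<chi> \<in> T"
  with elim show "\<exists>\<Gamma>. set \<Gamma> \<subseteq> T \<and> (\<forall>T'\<in>W. set \<Gamma> \<subseteq> T' \<longrightarrow> P T')"
    by (intro exI[of _ "[\<chi>]"]) simp
qed (use intro in blast)

text \<open>
  The truth lemma. For \<open>Exists\<close>, the translation \<open>Dia G (MExists (star \<phi>))\<close> amounts to
  \<open>MExists (star \<phi>)\<close> as \<open>Box G\<close> is the identity, and theories have witnesses.
\<close>

theorem holds_star_iff:
  "in_lang L \<phi> \<Longrightarrow> T \<in> W \<Longrightarrow> holds W e (star \<phi>) T \<longleftrightarrow> rename e \<phi> \<in> T"
proof (induction \<phi> arbitrary: e T)
  case (Rel p xs)
  then show ?case
    by (auto intro: exI[of _ "[Rel p (map e xs)]"])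
next
  case (Eq x y)
  then show ?case
    by (auto intro: exI[of _ "[Eq (e x) (e y)]"])
next
  case (Neg \<phi>)
  have "(\<exists>\<Gamma>. set \<Gamma> \<subseteq> T \<and> (\<forall>T'\<in>W. set \<Gamma> \<subseteq> T' \<longrightarrow> rename e \<phi> \<notin> T')) \<longleftrightarrow> Neg (rename e \<phi>) \<in> T"
    using Neg.prems by (intro box_member_iff) (auto dest: consistent intro: NegI)
  with Neg show ?case
    by simp
next
  case (And \<phi> \<psi>)
  then show ?case
    by (simp add: And_iff)
next
  case (Or \<phi> \<psi>)
  then show ?case
    by (simp add: Or_iff)
next
  case (Imp \<phi> \<psi>)
  have "(\<exists>\<Gamma>. set \<Gamma> \<subseteq> T \<and> (\<forall>T'\<in>W. set \<Gamma> \<subseteq> T' \<longrightarrow> rename e \<phi> \<in> T' \<longrightarrow> rename e \<psi> \<in> T')) \<longleftrightarrow>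
      Imp (rename e \<phi>) (rename e \<psi>) \<in> T"
    using Imp.prems by (intro box_member_iff) (auto dest: Imp_mp intro: ImpI)
  with Imp show ?case
    by simp
next
  case (Forall \<phi>)
  let ?\<phi> = "rename (under_binder e) \<phi>"
  have "(\<exists>\<Gamma>. set \<Gamma> \<subseteq> T \<and> (\<forall>T'\<in>W. set \<Gamma> \<subseteq> T' \<longrightarrow> (\<forall>x. inst x ?\<phi> \<in> T'))) \<longleftrightarrow> Forall ?\<phi> \<in> T"
    using Forall.prems by (intro box_member_iff) (auto dest: Forall_inst intro: ForallI)
  with Forall show ?case
    by (simp add: inst_rename_under_binder)
next
  case (Exists \<phi>)
  then show ?case
    by (simp add: Exists_iff inst_rename_under_binder)
qed

theorem member_if_bm_thm:
  assumes "bm_thm L' Y (conj_imp (map star \<Gamma>) (star \<psi>))" "ident L' \<longrightarrow> ident L"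
    and "\<And>\<phi> e T. \<phi> \<in> Y \<Longrightarrow> T \<in> W \<Longrightarrow> holds W e \<phi> T"
    and "\<forall>\<chi>\<in>set \<Gamma>. in_lang L \<chi>" "in_lang L \<psi>" "T \<in> W" "set \<Gamma> \<subseteq> T"
  shows "\<psi> \<in> T"
proof -
  have "holds W id (conj_imp (map star \<Gamma>) (star \<psi>)) T"
    using assms(1-3,6) by (rule bm_thm_holds)
  then show ?thesis
    using assms(4-7) by (auto simp: holds_conj_imp holds_star_iff)
qed

end

text \<open>
  A formula that belongs to all saturated theories containing \<open>\<Gamma>\<close> is derivable from \<open>\<Gamma>\<close>; the
  conditions on the model thus reduce to the introduction rules of natural deduction.
\<close>

lemma intuitionistic_canonical_model:
  assumes "countable (rels L)"
  shows "canonical_model L {} {T. saturated L {} T}"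
proof -
  interpret theories L "{}" "{T. saturated L {} T}"
    by standard simp
  have extension: "\<exists>T. saturated L {} T \<and> set \<Gamma> \<subseteq> T \<and> \<psi> \<notin> T"
    if "\<forall>\<chi>\<in>set \<Gamma>. in_lang L \<chi>" "in_lang L \<psi>" "\<not> natded L {} \<Gamma> \<psi>" for \<Gamma> \<psi>
    using saturated_extension[of "{}"] assms that by simp
  show ?thesis
  proof
    fix T \<phi> \<psi> \<Gamma>
    assume T: "T \<in> {T. saturated L {} T}" and lang: "in_lang L \<phi>" "in_lang L \<psi>" and \<Gamma>: "set \<Gamma> \<subseteq> T"
      and forces: "\<And>T'. T' \<in> {T. saturated L {} T} \<Longrightarrow> set \<Gamma> \<subseteq> T' \<Longrightarrow> \<phi> \<in> T' \<Longrightarrow> \<psi> \<in> T'"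
    have "natded L {} (\<phi> # \<Gamma>) \<psi>"
      using extension[of "\<phi> # \<Gamma>" \<psi>] in_lang[OF T] lang \<Gamma> forces by auto
    from closed[OF T natded.ImpI[OF this] \<Gamma>] show "Imp \<phi> \<psi> \<in> T" .
  next
    fix T \<phi> \<Gamma>
    assume T: "T \<in> {T. saturated L {} T}" and lang: "in_lang L \<phi>" and \<Gamma>: "set \<Gamma> \<subseteq> T"
      and forces: "\<And>T'. T' \<in> {T. saturated L {} T} \<Longrightarrow> set \<Gamma> \<subseteq> T' \<Longrightarrow> \<phi> \<notin> T'"
    have lang': "\<forall>\<chi>\<in>set (\<phi> # \<Gamma>). in_lang L \<chi>"
      using in_lang[OF T] lang \<Gamma> by auto
    then have "natded L {} (\<phi> # \<Gamma>) \<phi>"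
      by (intro natded.Assm) auto
    \<comment> \<open>No point contains \<open>\<phi> # \<Gamma>\<close>, so this list proves everything, in particular \<open>Neg \<phi>\<close>.\<close>
    moreover have "natded L {} (\<phi> # \<Gamma>) (Neg \<phi>)"
      using extension[of "\<phi> # \<Gamma>" "Neg \<phi>"] lang' forces by auto
    ultimately have "natded L {} \<Gamma> (Neg \<phi>)"
      by (rule natded.NegI)
    from closed[OF T this \<Gamma>] show "Neg \<phi> \<in> T" .
  next
    fix T \<phi> \<Gamma>
    assume T: "T \<in> {T. saturated L {} T}" and lang: "in_lang L \<phi>" and \<Gamma>: "set \<Gamma> \<subseteq> T"
      and forces: "\<And>T' x. T' \<in> {T. saturated L {} T} \<Longrightarrow> set \<Gamma> \<subseteq> T' \<Longrightarrow> inst x \<phi> \<in> T'"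
    have "natded L {} \<Gamma> (inst x \<phi>)" for x
    proof (rule ccontr)
      assume "\<not> natded L {} \<Gamma> (inst x \<phi>)"
      with extension[of \<Gamma> "inst x \<phi>"] in_lang[OF T] lang \<Gamma>
      obtain T' where "saturated L {} T'" "set \<Gamma> \<subseteq> T'" "inst x \<phi> \<notin> T'"
        by auto
      with forces[of T' x] show False
        by simp
    qed
    then have "natded L {} \<Gamma> (Forall \<phi>)"
      by (intro natded_generalize) simp_all
    from closed[OF T this \<Gamma>] show "Forall \<phi> \<in> T" .
  qed
qed

abbreviation excluded_middle :: "'p fm set" where
  "excluded_middle \<equiv> {Or \<phi> (Neg \<phi>) |\<phi>. True}"

lemma natded_not_ex_not:
  assumes "in_lang L \<phi>"
  shows "natded L excluded_middle [Neg (Exists (Neg \<phi>))] (Forall \<phi>)"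
proof (rule natded.ForallI)
  let ?X = "excluded_middle :: 'a fm set"
  let ?\<psi> = "lift (Neg (Exists (Neg \<phi>)))"
  have "natded L ?X [Neg \<phi>, ?\<psi>] (inst 0 (rename (under_binder Suc) (Neg \<phi>)))"
    unfolding inst_0_lift_under_binder using assms by (intro natded.Assm) auto
  then have "natded L ?X [Neg \<phi>, ?\<psi>] (Exists (rename (under_binder Suc) (Neg \<phi>)))"
    by (rule natded.ExistsI)
  from natded.NegE[OF natded.Assm this] have neg: "natded L ?X [Neg \<phi>, ?\<psi>] \<phi>"
    using assms by simp
  have "natded L ?X [?\<psi>] (Or \<phi> (Neg \<phi>))"
    using assms by (intro natded.Extra) auto
  moreover have "natded L ?X [\<phi>, ?\<psi>] \<phi>"
    using assms by (intro natded.Assm) auto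
  ultimately have "natded L ?X [?\<psi>] \<phi>"
    using neg by (rule natded.OrE)
  then show "natded L ?X (map lift [Neg (Exists (Neg \<phi>))]) \<phi>"
    by simp
qed

text \<open>
  A prime theory with excluded middle is complete, so membership in the single point commutes with
  the classical truth conditions. For \<open>Forall\<close>, a witness for \<open>Exists (Neg \<phi>)\<close> would contradict the
  instances of \<open>\<phi>\<close>.
\<close>

lemma classical_canonical_model:
  assumes "saturated L excluded_middle T"
  shows "canonical_model L excluded_middle {T}"
proof -
  interpret theories L excluded_middle "{T}"
    using assms by unfold_locales simp
  have T: "T \<in> {T}"
    by simp
  have decided: "\<phi> \<in> T \<or> Neg \<phi> \<in> T" if "in_lang L \<phi>" for \<phi>
  proof -
    have "natded L excluded_middle [] (Or \<phi> (Neg \<phi>))"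
      using that by (intro natded.Extra) auto
    from closed[OF T this] show ?thesis
      using that Or_iff[OF T] by simp
  qed
  show ?thesis
  proof
    fix T0 \<phi> \<psi> \<Gamma>
    assume lang: "in_lang L \<phi>" "in_lang L \<psi>"
      and T0: "T0 \<in> {T}" "set \<Gamma> \<subseteq> T0"
      and forces: "\<And>T'. T' \<in> {T} \<Longrightarrow> set \<Gamma> \<subseteq> T' \<Longrightarrow> \<phi> \<in> T' \<Longrightarrow> \<psi> \<in> T'"
    have "natded L excluded_middle [\<phi>, Neg \<phi>] \<psi>"
      by (rule natded.NegE[OF natded.Assm[of _ _ "Neg \<phi>"] natded.Assm]) (use lang in auto)
    then have "natded L excluded_middle [Neg \<phi>] (Imp \<phi> \<psi>)"
      by (rule natded.ImpI)
    moreover have "natded L excluded_middle [\<psi>] (Imp \<phi> \<psi>)"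
      using lang by (intro natded.ImpI natded.Assm) auto
    moreover have "Neg \<phi> \<in> T \<or> \<psi> \<in> T"
      using decided[OF lang(1)] forces T0 by auto
    ultimately show "Imp \<phi> \<psi> \<in> T0"
      using closed[OF T] T0 by auto
  next
    fix T0 \<phi> \<Gamma>
    assume "in_lang L \<phi>" "T0 \<in> {T}" "set \<Gamma> \<subseteq> T0" "\<And>T'. T' \<in> {T} \<Longrightarrow> set \<Gamma> \<subseteq> T' \<Longrightarrow> \<phi> \<notin> T'"
    then show "Neg \<phi> \<in> T0"
      using decided by auto
  next
    fix T0 \<phi> \<Gamma>
    assume lang: "in_lang L \<phi>" and T0: "T0 \<in> {T}" "set \<Gamma> \<subseteq> T0"
      and forces: "\<And>T' x. T' \<in> {T} \<Longrightarrow> set \<Gamma> \<subseteq> T' \<Longrightarrow> inst x \<phi> \<in> T'"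
    have "Exists (Neg \<phi>) \<notin> T"
      using Exists_iff[OF T, of "Neg \<phi>"] lang forces[OF T] T0 consistent[OF T] by auto
    then have "Neg (Exists (Neg \<phi>)) \<in> T"
      using decided[of "Exists (Neg \<phi>)"] lang by simp
    then show "Forall \<phi> \<in> T0"
      using closed[OF T natded_not_ex_not[OF lang]] T0 by simp
  qed
qed

section \<open>Faithfulness\<close>

primrec relations :: "'p fm \<Rightarrow> ('p \<times> nat) set" where
  "relations (Rel p xs) = {(p, length xs)}"
| "relations (Eq x y) = {}"
| "relations (Neg \<phi>) = relations \<phi>"
| "relations (And \<phi> \<psi>) = relations \<phi> \<union> relations \<psi>"
| "relations (Or \<phi> \<psi>) = relations \<phi> \<union> relations \<psi>"
| "relations (Imp \<phi> \<psi>) = relations \<phi> \<union> relations \<psi>"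
| "relations (Forall \<phi>) = relations \<phi>"
| "relations (Exists \<phi>) = relations \<phi>"

lemma finite_relations: "finite (relations \<phi>)"
  by (induction \<phi>) simp_all

lemma relations_subset: "in_lang L \<phi> \<Longrightarrow> relations \<phi> \<subseteq> rels L"
  by (induction \<phi>) simp_all

lemma in_sublanguage: "in_lang L \<phi> \<Longrightarrow> relations \<phi> \<subseteq> R \<Longrightarrow> in_lang (L\<lparr>rels := R\<rparr>) \<phi>"
  by (induction \<phi>) simp_all

text \<open>
  Completeness for arbitrary languages, by passing to the finitely many predicate symbols that occur
  in the sequent.
\<close>

lemma natded_if_saturated:
  assumes lang: "\<forall>\<chi>\<in>set \<Gamma>. in_lang L \<chi>" "in_lang L \<psi>"
    and X: "\<And>r \<chi>. \<chi> \<in> X \<Longrightarrow> rename r \<chi> \<in> X"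
    and valid: "\<And>L' T. countable (rels L') \<Longrightarrow> ident L' = ident L \<Longrightarrow>
      \<forall>\<chi>\<in>set (\<psi> # \<Gamma>). in_lang L' \<chi> \<Longrightarrow> saturated L' X T \<Longrightarrow> set \<Gamma> \<subseteq> T \<Longrightarrow> \<psi> \<in> T"
  shows "natded L X \<Gamma> \<psi>"
proof -
  define R where "R = (\<Union>\<chi>\<in>set (\<psi> # \<Gamma>). relations \<chi>)"
  have "\<forall>\<chi>\<in>set (\<psi> # \<Gamma>). in_lang L \<chi>"
    using lang by simp
  then have R: "finite R" "R \<subseteq> rels L" "\<forall>\<chi>\<in>set (\<psi> # \<Gamma>). in_lang (L\<lparr>rels := R\<rparr>) \<chi>"
    using relations_subset[of L] in_sublanguage[of L _ R]
    unfolding R_def by (simp add: finite_relations, blast, blast)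
  let ?L = "L\<lparr>rels := R\<rparr>"
  have countable: "countable (rels ?L)"
    using R(1) by (simp add: countable_finite)
  have "natded ?L X \<Gamma> \<psi>"
  proof (rule ccontr)
    assume "\<not> natded ?L X \<Gamma> \<psi>"
    then obtain T where "saturated ?L X T" "set \<Gamma> \<subseteq> T" "\<psi> \<notin> T"
      using saturated_extension[OF X countable, of \<Gamma> \<psi>] R(3) by auto
    with valid[of ?L T] countable R(3) show False
      by auto
  qed
  then show ?thesis
    by (rule natded_mono_lang) (use R(2) in simp_all)
qed

theorem IFOL_if_BMFOL_star:
  assumes "\<forall>\<chi>\<in>set \<Gamma>. in_lang L \<chi>" "in_lang L \<psi>" "BMFOL L (map star \<Gamma>) (star \<psi>)"
  shows "IFOL L \<Gamma> \<psi>"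
  unfolding IFOL_def
proof (rule natded_if_saturated[OF assms(1,2)])
  fix L' T
  assume L': "countable (rels L')" "ident L' = ident L" "\<forall>\<chi>\<in>set (\<psi> # \<Gamma>). in_lang L' \<chi>"
    and T: "saturated L' {} T" "set \<Gamma> \<subseteq> T"
  interpret canonical_model L' "{}" "{T. saturated L' {} T}"
    using L'(1) by (rule intuitionistic_canonical_model)
  show "\<psi> \<in> T"
    by (rule member_if_bm_thm[OF assms(3)[unfolded BMFOL_def]]) (use L' T in auto)
qed simp

theorem FOL_if_BMFOL_RS_star:
  assumes "\<forall>\<chi>\<in>set \<Gamma>. in_lang L \<chi>" "in_lang L \<psi>" "BMFOL_RS L (map star \<Gamma>) (star \<psi>)"
  shows "FOL L \<Gamma> \<psi>"
  unfolding FOL_def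
proof (rule natded_if_saturated[OF assms(1,2)])
  fix L' T
  assume L': "ident L' = ident L" "\<forall>\<chi>\<in>set (\<psi> # \<Gamma>). in_lang L' \<chi>"
    and T: "saturated L' excluded_middle T" "set \<Gamma> \<subseteq> T"
  interpret canonical_model L' excluded_middle "{T}"
    using T(1) by (rule classical_canonical_model)
  have nbhd: "\<exists>\<Delta>. set \<Delta> \<subseteq> T"
    by (rule exI[of _ "[]"]) simp
  have reverse_subsumption: "holds {T} e \<phi> T'"
    if "\<phi> \<in> {Box G \<phi> \<^bold>\<rightarrow> Box D \<phi> |\<phi>. True}" "T' \<in> {T}" for e \<phi> T'
    using that by clarify (simp add: nbhd)
  show "\<psi> \<in> T"
    by (rule member_if_bm_thm[OF assms(3)[unfolded BMFOL_RS_def] _ reverse_subsumption])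
      (use L' T in auto)
qed auto

theorem theorem4:
  fixes L :: "'p lang"
  shows
    "(\<forall>\<Gamma> \<psi>. (\<forall>\<phi> \<in> set \<Gamma>. in_lang L \<phi>) \<and> in_lang L \<psi> \<longrightarrow>
        (IFOL L \<Gamma> \<psi> \<longleftrightarrow> BMFOL L (map star \<Gamma>) (star \<psi>))) \<and>
     (\<forall>\<Gamma> \<psi>. (\<forall>\<phi> \<in> set \<Gamma>. in_lang L \<phi>) \<and> in_lang L \<psi> \<longrightarrow>
        (FOL L \<Gamma> \<psi> \<longleftrightarrow> BMFOL_RS L (map star \<Gamma>) (star \<psi>)))"
proof (intro conjI allI impI iffI)
  fix \<Gamma> :: "'p fm list" and \<psi> :: "'p fm"
  assume lang: "(\<forall>\<phi> \<in> set \<Gamma>. in_lang L \<phi>) \<and> in_lang L \<psi>"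
  show "BMFOL L (map star \<Gamma>) (star \<psi>)" if "IFOL L \<Gamma> \<psi>"
    using that by (rule BMFOL_star_if_IFOL)
  show "BMFOL_RS L (map star \<Gamma>) (star \<psi>)" if "FOL L \<Gamma> \<psi>"
    using that by (rule BMFOL_RS_star_if_FOL)
  show "IFOL L \<Gamma> \<psi>" if "BMFOL L (map star \<Gamma>) (star \<psi>)"
    using lang that by (intro IFOL_if_BMFOL_star) auto
  show "FOL L \<Gamma> \<psi>" if "BMFOL_RS L (map star \<Gamma>) (star \<psi>)"
    using lang that by (intro FOL_if_BMFOL_RS_star) auto
qed

end
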